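(* Let $\mathcal X\subset\mathbb R^n$ be a connected manifold with generalized boundary (MGB). Let $g$ and $h_1,\dots,h_k$ be real-valued $C^\infty$ functions of $(x,y)\in\mathcal X\times\mathbb R^m$ and, for $x\in\mathcal X$, let $\mathcal Y(x)=\{y\in\mathbb R^m: h_i(x,y)\le 0,\ i=1,\dots,k\}$. Assume that $\mathcal Y(x)\neq\emptyset$ for every $x\in\mathcal X$, that the sets $\mathcal Y(x)$ are uniformly bounded (there is $R>0$ with $\mathcal Y(x)\subset\{y:\|y\|\le R\}$ for all $x\in\mathcal X$), and that for every $x\in\mathcal X$ LICQ holds for the lower-level problem $\min_{y\in\mathcal Y(x)} g(x,y)$ at $x$. Then all the sets $\mathcal Y(x)$, $x\in\mathcal X$, share the same natural stratification as manifolds with generalized boundary: for any $x_1,x_2\in\mathcal X$ there exists a stratification-preserving diffeomorphism between $\mathcal Y(x_1)$ and $\mathcal Y(x_2)$.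
   Context: LICQ: for feasible $(x,y)$ let $\mathcal J(x,y)=\{i: h_i(x,y)=0\}$ be the active index set. LICQ holds for the lower-level problem at $x$ if for every $y\in\mathcal Y(x)$ the vectors $\{\nabla_y h_i(x,y): i\in\mathcal J(x,y)\}$ are linearly independent. MGB: a subset $X\subset\mathbb R^N$ is a manifold with generalized boundary (of class $C^\infty$) if for each $p_0\in X$ there is a local $C^\infty$ coordinate system $\psi:U\to V$ of $\mathbb R^N$ with $\psi(p_0)=0$ and integers $q,p\ge 0$ (possibly depending on $p_0$) such that $\psi(U\cap X)=\{v\in V: v_1=\dots=v_q=0,\ v_{q+1}\ge 0,\dots,v_{q+p}\ge 0\}$. Natural stratification: if an MGB $X\subset\mathbb R^N$ has dimension $s$ (i.e. $q=N-s$ at all points), put $\Sigma^\ell=\{p_0\in X: p(p_0)=s-\ell\}$ for $0\le\ell\le s$; each path-component of $\Sigma^\ell$ is an $\ell$-dimensional stratum. Under LICQ, $\mathcal Y(x)$ is an MGB and its strata are exactly the connected components of the sets $\{y\in\mathcal Y(x):\mathcal J(x,y)=\mathcal J\}$, $\mathcal J\subseteq\{1,\dots,k\}$. A map between subsets of Euclidean spaces is $C^\infty$ if locally it extends to a $C^\infty$ map on an open set; a diffeomorphism is a bijection that is $C^\infty$ with $C^\infty$ inverse. It is stratification-preserving if it maps each stratum of one set onto a stratum of the other. *)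

theory Defs
  imports "HOL-Analysis.Analysis"
begin

(* Continuous differentiability of order k; intended for open S only, since the
   derivatives are taken with respect to the full neighbourhood filter. *)
primrec Ck_on :: "nat \<Rightarrow> 'a::euclidean_space set \<Rightarrow> ('a \<Rightarrow> 'b::euclidean_space) \<Rightarrow> bool" where
  "Ck_on 0 S f \<longleftrightarrow> continuous_on S f"
| "Ck_on (Suc k) S f \<longleftrightarrow>
     (\<forall>x\<in>S. f differentiable (at x)) \<and>
     (\<forall>v. Ck_on k S (\<lambda>x. frechet_derivative f (at x) v))"

(* For open S this is ordinary C-infinity; for arbitrary S it asks for local C-infinity extensions. *)
definition smooth_on :: "'a::euclidean_space set \<Rightarrow> ('a \<Rightarrow> 'b::euclidean_space) \<Rightarrow> bool" where
  "smooth_on S f \<longleftrightarrow>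
     (\<forall>p\<in>S. \<exists>U F. open U \<and> p \<in> U \<and> (\<forall>k. Ck_on k U F) \<and> (\<forall>z\<in>U \<inter> S. F z = f z))"

definition diffeomorphism_between ::
    "'a::euclidean_space set \<Rightarrow> 'b::euclidean_space set \<Rightarrow> ('a \<Rightarrow> 'b) \<Rightarrow> bool" where
  "diffeomorphism_between A B f \<longleftrightarrow>
     bij_betw f A B \<and> smooth_on A f \<and> smooth_on B (inv_into A f)"

(* The index type 'n carries no order, so the numbering v_1, ..., v_N of the coordinates is
   given by the enumeration e; different charts may use different enumerations, which
   amounts to composing the chart with a permutation of coordinates. *)
definition mgb_at :: "(real^'n) set \<Rightarrow> real^'n \<Rightarrow> nat \<Rightarrow> nat \<Rightarrow> bool" where
  "mgb_at X p0 q p \<longleftrightarrow> q + p \<le> CARD('n) \<and>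
     (\<exists>U V (\<psi> :: real^'n \<Rightarrow> real^'n) (e :: nat \<Rightarrow> 'n).
        open U \<and> open V \<and> diffeomorphism_between U V \<psi> \<and> p0 \<in> U \<and> \<psi> p0 = 0 \<and>
        bij_betw e {1..CARD('n)} UNIV \<and>
        \<psi> ` (U \<inter> X) =
          {v \<in> V. (\<forall>i\<in>{1..q}. v $ e i = 0) \<and> (\<forall>i\<in>{q+1..q+p}. v $ e i \<ge> 0)})"

definition mgb :: "(real^'n) set \<Rightarrow> bool" where
  "mgb X \<longleftrightarrow> (\<forall>p0\<in>X. \<exists>q p. mgb_at X p0 q p)"

definition mgb_of_dim :: "nat \<Rightarrow> (real^'n) set \<Rightarrow> bool" where
  "mgb_of_dim s X \<longleftrightarrow> s \<le> CARD('n) \<and> (\<forall>p0\<in>X. \<exists>p. mgb_at X p0 (CARD('n) - s) p)"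

definition Sigma_stratum :: "nat \<Rightarrow> (real^'n) set \<Rightarrow> nat \<Rightarrow> (real^'n) set" where
  "Sigma_stratum s X l = {p0 \<in> X. mgb_at X p0 (CARD('n) - s) (s - l)}"

definition strata :: "nat \<Rightarrow> (real^'n) set \<Rightarrow> (real^'n) set set" where
  "strata s X =
     {path_component_set (Sigma_stratum s X l) z | l z. l \<le> s \<and> z \<in> Sigma_stratum s X l}"

definition stratification_preserving ::
    "nat \<Rightarrow> (real^'n) set \<Rightarrow> (real^'n) set \<Rightarrow> (real^'n \<Rightarrow> real^'n) \<Rightarrow> bool" where
  "stratification_preserving s A B f \<longleftrightarrow> (\<forall>S\<in>strata s A. f ` S \<in> strata s B)"

definition feasible_set ::
    "nat \<Rightarrow> (nat \<Rightarrow> real^'n \<Rightarrow> real^'m \<Rightarrow> real) \<Rightarrow> real^'n \<Rightarrow> (real^'m) set" where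
  "feasible_set k h x = {y. \<forall>i\<in>{1..k}. h i x y \<le> 0}"

definition active_set ::
    "nat \<Rightarrow> (nat \<Rightarrow> real^'n \<Rightarrow> real^'m \<Rightarrow> real) \<Rightarrow> real^'n \<Rightarrow> real^'m \<Rightarrow> nat set" where
  "active_set k h x y = {i\<in>{1..k}. h i x y = 0}"

definition gradient :: "(real^'m \<Rightarrow> real) \<Rightarrow> real^'m \<Rightarrow> real^'m" where
  "gradient f y = (THE D. GDERIV f y :> D)"

(* Linear independence of the active gradients is that of the indexed family: equal
   gradients of two distinct active constraints count as dependent, hence the
   injectivity condition.  The objective function of the problem plays no role. *)
definition LICQ ::
    "nat \<Rightarrow> (nat \<Rightarrow> real^'n \<Rightarrow> real^'m \<Rightarrow> real) \<Rightarrow> real^'n \<Rightarrow> bool" where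
  "LICQ k h x \<longleftrightarrow>
     (\<forall>y\<in>feasible_set k h x.
        inj_on (\<lambda>i. gradient (h i x) y) (active_set k h x y) \<and>
        independent ((\<lambda>i. gradient (h i x) y) ` active_set k h x y))"

end

theory Submission
  imports Defs
begin

text \<open>For \<open>x\<close> near \<open>x0\<close> a diffeomorphism from the feasible set at \<open>x0\<close> to the one at \<open>x\<close> is given by
  solving, for \<open>(z, t)\<close> near \<open>(y, 0)\<close>, the system
  \<open>z = y + (\<Sum>i. t i *\<^sub>R gradient (h i x0) y)\<close> and \<open>h i x z = (1 + t i) * h i x0 y\<close> for all \<open>i\<close>.
  The second equation makes the signs of all constraints agree, so feasible points go to feasible
  points. At feasible \<open>y\<close> the linearisation is governed by the Gram matrix of the gradients plus the
  diagonal matrix of the slacks \<open>- h i x0 y \<ge> 0\<close>; LICQ makes it regular, and the inverse function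
  theorem applies both to \<open>y \<mapsto> z\<close> and to \<open>z \<mapsto> y\<close>. Compactness turns this into a bijection of the
  feasible sets that locally extends to diffeomorphisms of the ambient space; such a map transports
  charts and hence strata. Being so related is an equivalence relation on the connected set \<open>X\<close>
  with open classes, so there is only one class.\<close>

text \<open>The obstacle is that the active set changes along the feasible set, so a map built from
  the active constraints near one point need not match the map built near another. The system treats
  all constraints alike: an active set enters only when the system is solved near a given point, and
  the local solutions agree on overlaps because small solutions are unique. Asking for
  \<open>h i x z = h i x0 y\<close> for all i would overdetermine z, since k may exceed the
  dimension. The factors \<open>1 + t i\<close> give as many unknowns (z, t) as equations, and they
  preserve signs once every t i is smaller than 1 in absolute value. Strata are defined through
  charts on open subsets of the ambient space. Hence the map is built to be, near each feasible
  point, the restriction of an ambient diffeomorphism rather than merely smooth on the feasible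
  set.\<close>

section \<open>Calculus of functions of class \<open>C\<^sup>k\<close>\<close>

lemma Ck_on_Suc_has_derivative:
  assumes "Ck_on (Suc k) S f" "x \<in> S"
  shows "(f has_derivative frechet_derivative f (at x)) (at x)"
  using assms by (simp add: frechet_derivative_works)

lemma Ck_on_subset: "Ck_on k S f \<Longrightarrow> T \<subseteq> S \<Longrightarrow> Ck_on k T f"
  by (induction k arbitrary: f) (auto intro: continuous_on_subset)

lemma Ck_on_cong:
  assumes "open S" "Ck_on k S f" "\<And>x. x \<in> S \<Longrightarrow> f x = g x"
  shows "Ck_on k S g"
  using assms(2,3)
proof (induction k arbitrary: f g)
  case 0
  then show ?case by (simp cong: continuous_on_cong)
next
  case (Suc k)
  have d: "(g has_derivative frechet_derivative f (at x)) (at x)" if "x \<in> S" for x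
    using Ck_on_Suc_has_derivative[OF Suc.prems(1) that] assms(1) that Suc.prems(2)
    by (rule has_derivative_transform_within_open)
  have "frechet_derivative g (at x) = frechet_derivative f (at x)" if "x \<in> S" for x
    using frechet_derivative_at[OF d[OF that]] by simp
  then have "Ck_on k S (\<lambda>x. frechet_derivative g (at x) v)" for v
    using Suc.IH[of "\<lambda>x. frechet_derivative f (at x) v"] Suc.prems by auto
  then show ?case using d by (auto simp: differentiable_def)
qed

text \<open>\<open>frechet_derivative\<close> picks a derivative by choice; uniqueness of
  derivatives lets any explicit formula stand in for it. The inductions on the order below rest on
  this.\<close>

lemma Ck_on_SucI:
  assumes "open S" "\<And>x. x \<in> S \<Longrightarrow> (f has_derivative f' x) (at x)"
    "\<And>v. Ck_on k S (\<lambda>x. f' x v)"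
  shows "Ck_on (Suc k) S f"
proof -
  have "frechet_derivative f (at x) = f' x" if "x \<in> S" for x
    using frechet_derivative_at[OF assms(2)[OF that]] by simp
  then have "Ck_on k S (\<lambda>x. frechet_derivative f (at x) v)" for v
    by (intro Ck_on_cong[OF assms(1) assms(3)[of v]]) auto
  then show ?thesis using assms(2) by (auto simp: differentiable_def)
qed

lemma Ck_on_Suc_imp: "Ck_on (Suc k) S f \<Longrightarrow> Ck_on k S f"
proof (induction k arbitrary: f)
  case 0
  then show ?case
    by (auto intro!: continuous_at_imp_continuous_on differentiable_imp_continuous_within)
next
  case (Suc k)
  then show ?case by (simp only: Ck_on.simps(2)) blast
qed

lemma Ck_on_imp_continuous_on: "Ck_on k S f \<Longrightarrow> continuous_on S f"
  by (induction k) (auto dest: Ck_on_Suc_imp simp del: Ck_on.simps(2))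

lemma Ck_on_const: "open S \<Longrightarrow> Ck_on k S (\<lambda>x. c)"
proof (induction k arbitrary: c)
  case (Suc k)
  then show ?case by (intro Ck_on_SucI[where f' = "\<lambda>x v. 0"]) auto
qed simp

lemma Ck_on_bounded_linear: "bounded_linear L \<Longrightarrow> open S \<Longrightarrow> Ck_on k S L"
  by (cases k)
    (auto simp: bounded_linear.linear linear_continuous_on
      intro!: Ck_on_SucI[where f' = "\<lambda>x. L"] Ck_on_const bounded_linear_imp_has_derivative
      simp del: Ck_on.simps(2))

lemma Ck_on_add:
  assumes "open S" "Ck_on k S f" "Ck_on k S g"
  shows "Ck_on k S (\<lambda>x. f x + g x)"
  using assms(2,3)
proof (induction k arbitrary: f g)
  case (Suc k)
  show ?case
  proof (rule Ck_on_SucI[OF assms(1)])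
    show "((\<lambda>x. f x + g x) has_derivative
        (\<lambda>v. frechet_derivative f (at x) v + frechet_derivative g (at x) v)) (at x)"
      if "x \<in> S" for x
      using that Suc.prems by (intro has_derivative_add Ck_on_Suc_has_derivative)
    show "Ck_on k S (\<lambda>x. frechet_derivative f (at x) v + frechet_derivative g (at x) v)" for v
      using Suc.IH Suc.prems by simp
  qed
qed (auto intro: continuous_intros)

lemma Ck_on_sum:
  assumes "open S" "\<And>i. i \<in> I \<Longrightarrow> Ck_on k S (f i)"
  shows "Ck_on k S (\<lambda>x. \<Sum>i\<in>I. f i x)"
  using assms(2)
  by (induction I rule: infinite_finite_induct)
    (auto intro!: Ck_on_const Ck_on_add assms(1))

lemma Ck_on_Pair:
  assumes "open S" "Ck_on k S f" "Ck_on k S g"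
  shows "Ck_on k S (\<lambda>x. (f x, g x))"
  using assms(2,3)
proof (induction k arbitrary: f g)
  case (Suc k)
  show ?case
  proof (rule Ck_on_SucI[OF assms(1)])
    show "((\<lambda>x. (f x, g x)) has_derivative
        (\<lambda>v. (frechet_derivative f (at x) v, frechet_derivative g (at x) v))) (at x)"
      if "x \<in> S" for x
      using that Suc.prems by (intro has_derivative_Pair Ck_on_Suc_has_derivative)
    show "Ck_on k S (\<lambda>x. (frechet_derivative f (at x) v, frechet_derivative g (at x) v))" for v
      using Suc.IH Suc.prems by simp
  qed
qed (auto intro: continuous_intros)

text \<open>Both terms of the product rule are again values of B, with one factor differentiated and
  the other lowered to order k. So the induction stays with the same B and covers scaling,
  multiplication and inner products at once.\<close>

lemma Ck_on_bilinear:
  fixes B :: "'b::euclidean_space \<Rightarrow> 'c::euclidean_space \<Rightarrow> 'd::euclidean_space"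
  assumes B: "bounded_bilinear B" and "open S" "Ck_on k S f" "Ck_on k S g"
  shows "Ck_on k S (\<lambda>x. B (f x) (g x))"
  using assms(3,4)
proof (induction k arbitrary: f g)
  case 0
  then show ?case by (simp add: bounded_bilinear.continuous_on[OF B])
next
  case (Suc k)
  show ?case
  proof (rule Ck_on_SucI[OF assms(2)])
    show "((\<lambda>x. B (f x) (g x)) has_derivative
        (\<lambda>v. B (f x) (frechet_derivative g (at x) v) + B (frechet_derivative f (at x) v) (g x))) (at x)"
      if "x \<in> S" for x
      using that Suc.prems by (intro bounded_bilinear.FDERIV[OF B] Ck_on_Suc_has_derivative)
    show "Ck_on k S (\<lambda>x. B (f x) (frechet_derivative g (at x) v) + B (frechet_derivative f (at x) v) (g x))" for v
      using Suc.prems Ck_on_Suc_imp[OF Suc.prems(1)] Ck_on_Suc_imp[OF Suc.prems(2)]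
      by (intro Ck_on_add[OF assms(2)] Suc.IH) auto
  qed
qed

lemmas Ck_on_scaleR = Ck_on_bilinear[OF bounded_bilinear_scaleR]
  and Ck_on_mult = Ck_on_bilinear[OF bounded_bilinear_mult[where 'a = real]]
  and Ck_on_inner = Ck_on_bilinear[OF bounded_bilinear_inner]

text \<open>The derivative involves \<open>inverse (f x)\<close> itself, which the induction
  hypothesis controls one order lower. The sign is written as the factor \<open>- 1\<close> so that
  \<open>Ck_on_mult\<close> applies.\<close>

lemma Ck_on_inverse:
  fixes f :: "'a::euclidean_space \<Rightarrow> real"
  assumes "open S" "Ck_on k S f" "\<And>x. x \<in> S \<Longrightarrow> f x \<noteq> 0"
  shows "Ck_on k S (\<lambda>x. inverse (f x))"
  using assms(2)
proof (induction k)
  case 0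
  then show ?case using assms(3) by (auto intro: continuous_intros)
next
  case (Suc k)
  note c = Suc.IH[OF Ck_on_Suc_imp[OF Suc.prems]]
  show ?case
  proof (rule Ck_on_SucI[OF assms(1)])
    show "((\<lambda>x. inverse (f x)) has_derivative
        (\<lambda>v. - 1 * (inverse (f x) * frechet_derivative f (at x) v * inverse (f x)))) (at x)"
      if "x \<in> S" for x
      using Deriv.has_derivative_inverse[OF assms(3)[OF that] Ck_on_Suc_has_derivative[OF Suc.prems that]]
      by simp
    show "Ck_on k S (\<lambda>x. - 1 * (inverse (f x) * frechet_derivative f (at x) v * inverse (f x)))" for v
      using Suc.prems by (intro Ck_on_mult[OF assms(1)] c Ck_on_const assms(1)) auto
  qed
qed

lemma linear_euclidean_expansion:
  fixes f :: "'a::euclidean_space \<Rightarrow> 'b::real_vector"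
  assumes "linear f"
  shows "f w = (\<Sum>b\<in>Basis. (w \<bullet> b) *\<^sub>R f b)"
proof -
  have "(\<Sum>b\<in>Basis. (w \<bullet> b) *\<^sub>R f b) = f (\<Sum>b\<in>Basis. (w \<bullet> b) *\<^sub>R b)"
    using assms by (simp only: linear_sum linear_scale)
  then show ?thesis by (simp only: euclidean_representation)
qed

text \<open>\<open>Ck_on\<close> controls derivatives in fixed directions, while the chain rule
  differentiates g in the direction \<open>frechet_derivative f (at x) v\<close>, which moves with
  x. Expanding that direction over the basis leaves fixed directions with coefficients of class
  k.\<close>

lemma Ck_on_compose:
  fixes g :: "'b::euclidean_space \<Rightarrow> 'c::euclidean_space"
    and f :: "'a::euclidean_space \<Rightarrow> 'b"
  assumes "open S" "open T" "Ck_on k S f" "Ck_on k T g" "f ` S \<subseteq> T"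
  shows "Ck_on k S (\<lambda>x. g (f x))"
  using assms(3,4)
proof (induction k arbitrary: g)
  case 0
  then show ?case using assms(5) by (auto intro: continuous_on_compose2)
next
  case (Suc k)
  have lin: "frechet_derivative g (at (f x)) w
      = (\<Sum>b\<in>Basis. (w \<bullet> b) *\<^sub>R frechet_derivative g (at (f x)) b)" if "x \<in> S" for x w
    using Ck_on_Suc_has_derivative[OF Suc.prems(2)] that assms(5)
    by (intro linear_euclidean_expansion has_derivative_linear) blast
  show ?case
  proof (rule Ck_on_SucI[OF assms(1)])
    show "((\<lambda>x. g (f x)) has_derivative
        (\<lambda>v. frechet_derivative g (at (f x)) (frechet_derivative f (at x) v))) (at x)"
      if "x \<in> S" for x
      using that Suc.prems assms(5)
      by (intro has_derivative_compose[of f _ _ _ g] Ck_on_Suc_has_derivative) auto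
    fix v
    have "Ck_on k S (\<lambda>x. \<Sum>b\<in>Basis. (frechet_derivative f (at x) v \<bullet> b) *\<^sub>R
            frechet_derivative g (at (f x)) b)"
      using Suc.prems Ck_on_Suc_imp[OF Suc.prems(1)]
      by (intro Ck_on_sum Ck_on_scaleR Ck_on_inner Ck_on_const assms(1) Suc.IH) auto
    then show "Ck_on k S (\<lambda>x. frechet_derivative g (at (f x)) (frechet_derivative f (at x) v))"
      by (rule Ck_on_cong[OF assms(1)]) (rule lin[symmetric])
  qed
qed

section \<open>Smooth inverse function theorem\<close>

text \<open>Because r vanishes at p, the product rule has no term with a derivative of m, and
  continuity of m suffices. This allows an expression in the inverse of a family of maps to be
  differentiated before that inverse is known to be differentiable.\<close>

lemma has_derivative_scaleR_vanishing:
  fixes r :: "'a::euclidean_space \<Rightarrow> real" and m :: "'a \<Rightarrow> 'b::euclidean_space"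
  assumes r: "(r has_derivative r') (at p)" and "r p = 0" and m: "isCont m p"
  shows "((\<lambda>x. r x *\<^sub>R m x) has_derivative (\<lambda>v. r' v *\<^sub>R m p)) (at p)"
proof -
  obtain Q where Q: "\<And>v. norm (r' v) \<le> norm v * Q"
    using bounded_linear.nonneg_bounded[OF has_derivative_bounded_linear[OF r]] by blast
  have lin: "bounded_linear (\<lambda>v. r' v *\<^sub>R m p)"
    using has_derivative_bounded_linear[OF r] by (rule bounded_linear_scaleR_const)
  have 1: "((\<lambda>x. (norm (r x - r p - r' (x - p)) / norm (x - p)) * norm (m x)) \<longlongrightarrow> 0 * norm (m p)) (at p)"
    using r m by (intro tendsto_mult tendsto_norm) (auto simp: has_derivative_iff_norm isCont_def)
  have 2: "((\<lambda>x. \<bar>Q\<bar> * norm (m x - m p)) \<longlongrightarrow> \<bar>Q\<bar> * norm (m p - m p)) (at p)"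
    using m by (intro tendsto_intros) (auto simp: isCont_def)
  have "((\<lambda>x. norm (r x *\<^sub>R m x - r p *\<^sub>R m p - r' (x - p) *\<^sub>R m p) / norm (x - p)) \<longlongrightarrow> 0) (at p)"
  proof (rule Lim_null_comparison)
    show "((\<lambda>x. (norm (r x - r p - r' (x - p)) / norm (x - p)) * norm (m x)
            + \<bar>Q\<bar> * norm (m x - m p)) \<longlongrightarrow> 0) (at p)"
      using tendsto_add[OF 1 2] by simp
    have "norm (r x *\<^sub>R m x - r p *\<^sub>R m p - r' (x - p) *\<^sub>R m p) / norm (x - p)
      \<le> (norm (r x - r p - r' (x - p)) / norm (x - p)) * norm (m x) + \<bar>Q\<bar> * norm (m x - m p)"
      if "x \<noteq> p" for x
    proof -
      have "r x *\<^sub>R m x - r p *\<^sub>R m p - r' (x - p) *\<^sub>R m p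
          = (r x - r p - r' (x - p)) *\<^sub>R m x + r' (x - p) *\<^sub>R (m x - m p)"
        using \<open>r p = 0\<close> by (simp add: algebra_simps)
      also have "norm \<dots> \<le> norm (r x - r p - r' (x - p)) * norm (m x) + norm (r' (x - p)) * norm (m x - m p)"
        by (metis norm_scaleR norm_triangle_ineq real_norm_def)
      also have "\<dots> \<le> norm (r x - r p - r' (x - p)) * norm (m x) + (norm (x - p) * \<bar>Q\<bar>) * norm (m x - m p)"
        using Q[of "x - p"] mult_left_mono[OF abs_ge_self[of Q] norm_ge_zero[of "x - p"]]
        by (intro add_left_mono mult_right_mono) auto
      finally show ?thesis using that by (simp add: field_simps)
    qed
    then show "\<forall>\<^sub>F x in at p. norm (norm (r x *\<^sub>R m x - r p *\<^sub>R m p - r' (x - p) *\<^sub>R m p) / norm (x - p))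
      \<le> (norm (r x - r p - r' (x - p)) / norm (x - p)) * norm (m x) + \<bar>Q\<bar> * norm (m x - m p)"
      by (simp add: eventually_at_filter)
  qed
  then show ?thesis using lin by (simp add: has_derivative_iff_norm)
qed

text \<open>Rests on the identity M x - M p = M x (L p - L x) M p. Continuity is given only vector
  by vector, so the sum \<open>B x\<close> of the norms of M x on the basis replaces the operator
  norm. The same identity bounds it: near p it yields B x \<le> B p + B x / 2, hence B x \<le> 2 * B
  p.\<close>

lemma continuous_on_inverse_family:
  fixes L M :: "'a::euclidean_space \<Rightarrow> 'b::euclidean_space \<Rightarrow> 'b"
  assumes S: "open S"
    and L: "\<And>x. x \<in> S \<Longrightarrow> linear (L x)" and M: "\<And>x. x \<in> S \<Longrightarrow> linear (M x)"
    and left: "\<And>x v. x \<in> S \<Longrightarrow> M x (L x v) = v" and right: "\<And>x v. x \<in> S \<Longrightarrow> L x (M x v) = v"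
    and cont: "\<And>v. continuous_on S (\<lambda>x. L x v)"
  shows "continuous_on S (\<lambda>x. M x v)"
proof -
  have "((\<lambda>x. M x v) \<longlongrightarrow> M p v) (at p)" if p: "p \<in> S" for p
  proof -
    define B where "B x = (\<Sum>c\<in>Basis. norm (M x c))" for x
    define d where "d v x = norm (L p (M p v) - L x (M p v))" for v x
    have evS: "\<forall>\<^sub>F x in at p. x \<in> S"
      using S p by (simp add: eventually_at_in_open')
    have d0: "(d v \<longlongrightarrow> 0) (at p)" for v
    proof -
      have "((\<lambda>x. L x (M p v)) \<longlongrightarrow> L p (M p v)) (at p)"
        using cont[of "M p v"] S p by (simp add: continuous_on_eq_continuous_at isCont_def)
      then have "((\<lambda>x. norm (L p (M p v) - L x (M p v))) \<longlongrightarrow> norm (L p (M p v) - L p (M p v))) (at p)"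
        by (intro tendsto_intros)
      then show ?thesis by (simp add: d_def[abs_def])
    qed
    have bound: "norm (M x w) \<le> norm w * B x" if "x \<in> S" for x w
    proof -
      have "M x w = (\<Sum>c\<in>Basis. (w \<bullet> c) *\<^sub>R M x c)"
        by (rule linear_euclidean_expansion[OF M[OF that]])
      also have "norm \<dots> \<le> (\<Sum>c\<in>Basis. norm ((w \<bullet> c) *\<^sub>R M x c))"
        by (rule norm_sum)
      also have "\<dots> \<le> (\<Sum>c\<in>Basis. norm w * norm (M x c))"
        by (intro sum_mono) (simp add: Basis_le_norm mult_right_mono)
      finally show ?thesis by (simp add: B_def sum_distrib_left)
    qed
    have diff: "norm (M x v - M p v) \<le> d v x * B x" if x: "x \<in> S" for x v
    proof -
      have "M x v - M p v = M x (L p (M p v) - L x (M p v))"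
        using left[OF x] right[OF p] linear_diff[OF M[OF x]] by simp
      then show ?thesis using bound[OF x] by (simp add: d_def)
    qed
    have B2: "\<forall>\<^sub>F x in at p. B x \<le> 2 * B p"
    proof -
      have "((\<lambda>x. \<Sum>c\<in>Basis. d c x) \<longlongrightarrow> (\<Sum>c\<in>(Basis::'b set). 0)) (at p)"
        by (intro tendsto_sum d0)
      then have "\<forall>\<^sub>F x in at p. (\<Sum>c\<in>Basis. d c x) < 1/2"
        by (intro order_tendstoD) auto
      with evS show ?thesis
      proof eventually_elim
        case (elim x)
        have "B x \<le> (\<Sum>c\<in>Basis. norm (M p c) + d c x * B x)"
          unfolding B_def[of x]
        proof (rule sum_mono)
          fix c :: 'b
          show "norm (M x c) \<le> norm (M p c) + d c x * (\<Sum>c\<in>Basis. norm (M x c))"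
            using diff[OF elim(1), of c] norm_triangle_sub[of "M x c" "M p c"] unfolding B_def by linarith
        qed
        also have "\<dots> = B p + (\<Sum>c\<in>Basis. d c x) * B x"
          by (simp add: B_def sum.distrib sum_distrib_right)
        also have "(\<Sum>c\<in>Basis. d c x) * B x \<le> 1/2 * B x"
          using elim(2) by (intro mult_right_mono) (auto simp: B_def sum_nonneg)
        finally show ?case by simp
      qed
    qed
    have "((\<lambda>x. M x v - M p v) \<longlongrightarrow> 0) (at p)"
    proof (rule Lim_null_comparison)
      show "\<forall>\<^sub>F x in at p. norm (M x v - M p v) \<le> d v x * (2 * B p)"
        using evS B2
      proof eventually_elim
        case (elim x)
        have "d v x * B x \<le> d v x * (2 * B p)"
          using elim(2) by (intro mult_left_mono) (auto simp: d_def)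
        then show ?case using diff[OF elim(1), of v] by linarith
      qed
      show "((\<lambda>x. d v x * (2 * B p)) \<longlongrightarrow> 0) (at p)"
        using tendsto_mult_right[OF d0, of v] by (metis mult_zero_left)
    qed
    then show ?thesis by (simp add: LIM_zero_iff)
  qed
  then show ?thesis by (simp add: S continuous_on_eq_continuous_at isCont_def)
qed

text \<open>Differentiates the identity M x v = u - M x (L x u - v), where u = M p v. The vector L x
  u - v vanishes at x = p, so \<open>has_derivative_scaleR_vanishing\<close> asks only for
  continuity of M there. The derivative is minus M after the derivative of L after M, which is of
  class k by the induction hypothesis.\<close>

lemma Ck_on_inverse_family:
  fixes L M :: "'a::euclidean_space \<Rightarrow> 'b::euclidean_space \<Rightarrow> 'b"
  assumes S: "open S"
    and L: "\<And>x. x \<in> S \<Longrightarrow> linear (L x)" and M: "\<And>x. x \<in> S \<Longrightarrow> linear (M x)"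
    and left: "\<And>x v. x \<in> S \<Longrightarrow> M x (L x v) = v" and right: "\<And>x v. x \<in> S \<Longrightarrow> L x (M x v) = v"
    and Ck: "\<And>v. Ck_on k S (\<lambda>x. L x v)"
  shows "Ck_on k S (\<lambda>x. M x v)"
  using Ck
proof (induction k arbitrary: v)
  case 0
  then show ?case using continuous_on_inverse_family[OF S L M left right] by simp
next
  case (Suc k)
  define D where "D b x w = frechet_derivative (\<lambda>y. L y b) (at x) w" for b x w
  have Ck_M: "Ck_on k S (\<lambda>x. M x v)" for v
    using Suc.IH Suc.prems by (blast intro: Ck_on_Suc_imp)
  have Ck_D: "Ck_on k S (\<lambda>x. D b x w)" for b w
    using Suc.prems[of b] by (simp add: D_def)
  have D: "((\<lambda>y. L y b) has_derivative D b x) (at x)" if "x \<in> S" for b x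
    using Ck_on_Suc_has_derivative[OF Suc.prems that] by (simp add: D_def[abs_def])
  have expand: "N w = (\<Sum>c\<in>Basis. (w \<bullet> c) *\<^sub>R N c)" if "linear N" for N :: "'b \<Rightarrow> 'b" and w
    by (rule linear_euclidean_expansion[OF that])
  show ?case
  proof (rule Ck_on_SucI[OF S])
    fix p assume p: "p \<in> S"
    define u where "u = M p v"
    \<comment> \<open>\<open>L x u\<close> is expanded over the basis because in the final
      derivative u becomes \<open>M x v\<close>, which varies with x, while \<open>Ck_D\<close>
      covers only fixed vectors b.\<close>
    define r where "r c x = ((\<Sum>b\<in>Basis. (u \<bullet> b) *\<^sub>R L x b) - v) \<bullet> c" for c x
    have r: "r c x = (L x u - v) \<bullet> c" if "x \<in> S" for c x
      unfolding r_def expand[OF L[OF that], of u] by simp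
    have r': "(r c has_derivative (\<lambda>w. (\<Sum>b\<in>Basis. (u \<bullet> b) *\<^sub>R D b p w) \<bullet> c)) (at p)" for c
      unfolding r_def[abs_def] using D[OF p] by (auto intro!: derivative_eq_intros)
    have "((\<lambda>x. u - (\<Sum>c\<in>Basis. r c x *\<^sub>R M x c)) has_derivative
        (\<lambda>w. 0 - (\<Sum>c\<in>Basis. ((\<Sum>b\<in>Basis. (u \<bullet> b) *\<^sub>R D b p w) \<bullet> c) *\<^sub>R M p c))) (at p)"
    proof (intro has_derivative_diff has_derivative_const has_derivative_sum has_derivative_scaleR_vanishing r')
      show "r c p = 0" for c using right[OF p] by (simp add: r[OF p] u_def)
      show "isCont (\<lambda>x. M x c) p" for c
        using Ck_on_imp_continuous_on[OF Ck_M] S p by (simp add: continuous_on_eq_continuous_at)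
    qed
    moreover have "u - (\<Sum>c\<in>Basis. r c x *\<^sub>R M x c) = M x v" if "x \<in> S" for x
    proof -
      have "(\<Sum>c\<in>Basis. r c x *\<^sub>R M x c) = M x (L x u - v)"
        by (simp add: r[OF that] expand[OF M[OF that], of "L x u - v"])
      then show ?thesis using left[OF that] linear_diff[OF M[OF that]] by simp
    qed
    ultimately have "((\<lambda>x. M x v) has_derivative
        (\<lambda>w. 0 - (\<Sum>c\<in>Basis. ((\<Sum>b\<in>Basis. (u \<bullet> b) *\<^sub>R D b p w) \<bullet> c) *\<^sub>R M p c))) (at p)"
      by (rule has_derivative_transform_within_open[OF _ S p])
    then show "((\<lambda>x. M x v) has_derivative
        (\<lambda>w. - 1 *\<^sub>R (\<Sum>c\<in>Basis. ((\<Sum>b\<in>Basis. (M p v \<bullet> b) *\<^sub>R D b p w) \<bullet> c) *\<^sub>R M p c))) (at p)"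
      by (simp add: u_def)
  next
    show "Ck_on k S (\<lambda>x. - 1 *\<^sub>R (\<Sum>c\<in>Basis. ((\<Sum>b\<in>Basis. (M x v \<bullet> b) *\<^sub>R D b x w) \<bullet> c) *\<^sub>R M x c))" for w
      by (intro Ck_on_scaleR Ck_on_sum Ck_on_inner Ck_M Ck_D Ck_on_const S)
  qed
qed

text \<open>Bootstrapping: the derivative of the local inverse g at y is the inverse of the
  derivative of f at g y. If g is of class k, then so is this derivative by
  \<open>Ck_on_inverse_family\<close>, and g gains one order.\<close>

lemma smooth_inverse_function:
  fixes f :: "'a::euclidean_space \<Rightarrow> 'a"
  assumes S: "open S" and f: "\<And>k. Ck_on k S f" and p: "p \<in> S"
    and f': "(f has_derivative f') (at p)" and ker: "\<And>v. f' v = 0 \<Longrightarrow> v = 0"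
  obtains U V g where "open U" "U \<subseteq> S" "p \<in> U" "open V" "homeomorphism U V f g"
    "\<And>k. Ck_on k V g"
proof -
  define D where "D x = Blinfun (frechet_derivative f (at x))" for x
  have der: "(f has_derivative frechet_derivative f (at x)) (at x)" if "x \<in> S" for x
    using Ck_on_Suc_has_derivative[OF f that] .
  have D: "blinfun_apply (D x) = frechet_derivative f (at x)" if "x \<in> S" for x
    unfolding D_def using der[OF that] by (simp add: bounded_linear_Blinfun_apply has_derivative_bounded_linear)
  have Ck_D: "Ck_on k S (\<lambda>x. D x v)" for k v
  proof (rule Ck_on_cong[OF S])
    show "Ck_on k S (\<lambda>x. frechet_derivative f (at x) v)"
      using f[of "Suc k"] by simp
  qed (simp add: D)
  have contD: "continuous_on S D"
    using Ck_D Ck_on_imp_continuous_on by (intro continuous_on_blinfun_componentwise) blast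
  have Dp: "blinfun_apply (D p) = f'"
    using D[OF p] frechet_derivative_at[OF f'] by simp
  have lin: "linear f'" using f' by (rule has_derivative_linear)
  have "inj f'" using ker lin linear_injective_0 by blast
  then obtain i where i: "linear i" "i \<circ> f' = id"
    using linear_injective_left_inverse[OF lin] by blast
  define I where "I = Blinfun i"
  have I: "blinfun_apply I = i"
    unfolding I_def using i(1) by (simp add: bounded_linear_Blinfun_apply linear_conv_bounded_linear)
  have inv: "I o\<^sub>L D p = id_blinfun"
    using i(2) by (intro blinfun_eqI) (simp add: I Dp fun_eq_iff)
  obtain U V g g' where g: "open U" "U \<subseteq> S" "p \<in> U" "open V" "f p \<in> V" "homeomorphism U V f g"
    "\<And>y. y \<in> V \<Longrightarrow> (g has_derivative g' y) (at y)"
    "\<And>y. y \<in> V \<Longrightarrow> g' y = inv (blinfun_apply (D (g y)))"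
    "\<And>y. y \<in> V \<Longrightarrow> bij (blinfun_apply (D (g y)))"
    using inverse_function_theorem[OF S _ contD p inv] der D by metis
  have gV: "g ` V \<subseteq> S" using g(2,6) by (auto simp: homeomorphism_def)
  have "Ck_on k V g" for k
  proof (induction k)
    case 0
    show ?case using g(6) by (simp add: homeomorphism_def)
  next
    case (Suc k)
    show ?case
    proof (rule Ck_on_SucI[OF g(4) g(7)])
      have "Ck_on k V (\<lambda>y. inv (blinfun_apply (D (g y))) v)" for v
      proof (rule Ck_on_inverse_family[OF g(4)])
        show "linear (blinfun_apply (D (g y)))" for y
          by (simp add: blinfun.bounded_linear_right bounded_linear.linear)
        show "linear (inv (blinfun_apply (D (g y))))" if "y \<in> V" for y
          using g(7)[OF that] g(8)[OF that] has_derivative_linear by metis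
        show "inv (blinfun_apply (D (g y))) (blinfun_apply (D (g y)) v) = v" if "y \<in> V" for y v
          using g(9)[OF that] by (simp add: bij_is_inj)
        show "blinfun_apply (D (g y)) (inv (blinfun_apply (D (g y))) v) = v" if "y \<in> V" for y v
          using g(9)[OF that] by (simp add: bij_is_surj surj_f_inv_f)
        show "Ck_on k V (\<lambda>y. blinfun_apply (D (g y)) v)" for v
          by (rule Ck_on_compose[OF g(4) S Suc Ck_D gV])
      qed
      then show "Ck_on k V (\<lambda>y. g' y v)" for v
        by (rule Ck_on_cong[OF g(4)]) (simp add: g(8))
    qed
  qed
  then show ?thesis using that g by blast
qed

section \<open>Smooth isomorphisms\<close>

lemma Ck_on_local:
  assumes "\<And>p. p \<in> S \<Longrightarrow> \<exists>U. open U \<and> p \<in> U \<and> Ck_on k U f"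
  shows "Ck_on k S f"
  using assms
proof (induction k arbitrary: f)
  case 0
  then show ?case
    by (metis Ck_on.simps(1) continuous_at_imp_continuous_on continuous_on_eq_continuous_at)
next
  case (Suc k)
  have "Ck_on k S (\<lambda>x. frechet_derivative f (at x) v)" for v
  proof (rule Suc.IH)
    fix p assume "p \<in> S"
    then obtain U where "open U" "p \<in> U" "Ck_on (Suc k) U f"
      using Suc.prems by blast
    then show "\<exists>U. open U \<and> p \<in> U \<and> Ck_on k U (\<lambda>x. frechet_derivative f (at x) v)"
      by (intro exI[of _ U]) simp
  qed
  moreover have "f differentiable (at x)" if "x \<in> S" for x
    using Suc.prems[OF that] by (simp only: Ck_on.simps(2)) blast
  ultimately show ?case by simp
qed

lemma smooth_onE:
  assumes "smooth_on S f" "p \<in> S"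
  obtains U F where "open U" "p \<in> U" "\<And>k. Ck_on k U F" "\<And>z. z \<in> U \<inter> S \<Longrightarrow> F z = f z"
  using bspec[OF iffD1[OF smooth_on_def assms(1)] assms(2)] by blast

lemma smooth_on_iff_open: "open S \<Longrightarrow> smooth_on S f \<longleftrightarrow> (\<forall>k. Ck_on k S f)"
proof
  assume S: "open S" and f: "smooth_on S f"
  show "\<forall>k. Ck_on k S f"
  proof
    fix k
    show "Ck_on k S f"
    proof (rule Ck_on_local)
      fix p assume "p \<in> S"
      then obtain U F where U: "open U" "p \<in> U" "\<And>k. Ck_on k U F" "\<And>z. z \<in> U \<inter> S \<Longrightarrow> F z = f z"
        using smooth_onE[OF f \<open>p \<in> S\<close>] by metis
      have "Ck_on k (U \<inter> S) f"
      proof (rule Ck_on_cong)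
        show "Ck_on k (U \<inter> S) F" using U(3) by (rule Ck_on_subset) auto
      qed (use S U in auto)
      then show "\<exists>U. open U \<and> p \<in> U \<and> Ck_on k U f"
        using S U \<open>p \<in> S\<close> by (intro exI[of _ "U \<inter> S"]) auto
    qed
  qed
qed (auto simp: smooth_on_def)

lemma smooth_on_subset: "smooth_on S f \<Longrightarrow> T \<subseteq> S \<Longrightarrow> smooth_on T f"
  unfolding smooth_on_def[of T]
proof
  fix p assume f: "smooth_on S f" and T: "T \<subseteq> S" and "p \<in> T"
  then have "p \<in> S" by blast
  obtain U F where "open U" "p \<in> U" "\<And>k. Ck_on k U F" "\<And>z. z \<in> U \<inter> S \<Longrightarrow> F z = f z"
    using smooth_onE[OF f \<open>p \<in> S\<close>] by metis
  then show "\<exists>U F. open U \<and> p \<in> U \<and> (\<forall>k. Ck_on k U F) \<and> (\<forall>z\<in>U \<inter> T. F z = f z)"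
    using T by (intro exI[of _ U] exI[of _ F]) auto
qed

lemma smooth_on_imp_continuous_on:
  assumes "smooth_on S f" shows "continuous_on S f"
  unfolding continuous_on_eq_continuous_within
proof
  fix p assume p: "p \<in> S"
  then obtain U F where U: "open U" "p \<in> U" "\<And>k. Ck_on k U F" "\<And>z. z \<in> U \<inter> S \<Longrightarrow> F z = f z"
    using smooth_onE[OF assms p] by metis
  have "continuous (at p within S) F"
    using U(1,2) Ck_on_imp_continuous_on[OF U(3)]
    by (auto simp: continuous_on_eq_continuous_at intro: continuous_at_imp_continuous_at_within)
  moreover have "\<forall>\<^sub>F z in at p within S. F z = f z"
    using U(1,2,4) by (auto simp: eventually_at_topological)
  moreover have "F p = f p" using U(2,4) p by simp
  ultimately show "continuous (at p within S) f"
    by (simp add: continuous_within tendsto_cong)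
qed

lemma smooth_on_compose:
  assumes f: "smooth_on S f" and g: "smooth_on T g" and fST: "f ` S \<subseteq> T"
  shows "smooth_on S (\<lambda>x. g (f x))"
  unfolding smooth_on_def
proof
  fix p assume p: "p \<in> S"
  then obtain U F where U: "open U" "p \<in> U" "\<And>k. Ck_on k U F" "\<And>z. z \<in> U \<inter> S \<Longrightarrow> F z = f z"
    using smooth_onE[OF f \<open>p \<in> S\<close>] by metis
  obtain V G where V: "open V" "f p \<in> V" "\<And>k. Ck_on k V G" "\<And>z. z \<in> V \<inter> T \<Longrightarrow> G z = g z"
    using smooth_onE[OF g, of "f p"] fST p by (metis image_subset_iff)
  have W: "open (U \<inter> F -` V)"
    using Ck_on_imp_continuous_on[OF U(3)] U(1) V(1) by (rule continuous_open_preimage)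
  have "Ck_on k (U \<inter> F -` V) (\<lambda>x. G (F x))" for k
    by (rule Ck_on_compose[OF W V(1) Ck_on_subset[OF U(3)] V(3)]) auto
  then show "\<exists>W H. open W \<and> p \<in> W \<and> (\<forall>k. Ck_on k W H) \<and> (\<forall>z\<in>W \<inter> S. H z = g (f z))"
    using W p U V fST by (intro exI[of _ "U \<inter> F -` V"] exI[of _ "\<lambda>x. G (F x)"]) auto
qed

lemma smooth_on_local:
  assumes "\<And>p. p \<in> S \<Longrightarrow> \<exists>U f. open U \<and> p \<in> U \<and> smooth_on U f \<and> (\<forall>z\<in>U \<inter> S. f z = g z)"
  shows "smooth_on S g"
  using assms unfolding smooth_on_def[of S] by (metis smooth_on_iff_open)

text \<open>The inverse is carried along as an argument because \<open>inv_into\<close> depends on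
  the domain, whereas g remains the inverse after restriction to a smaller open set.\<close>

definition smooth_iso ::
  "'a::euclidean_space set \<Rightarrow> 'b::euclidean_space set \<Rightarrow> ('a \<Rightarrow> 'b) \<Rightarrow> ('b \<Rightarrow> 'a) \<Rightarrow> bool" where
  "smooth_iso U V f g \<longleftrightarrow>
     open U \<and> open V \<and> homeomorphism U V f g \<and> smooth_on U f \<and> smooth_on V g"

lemma smooth_iso_sym: "smooth_iso U V f g \<Longrightarrow> smooth_iso V U g f"
  by (auto simp: smooth_iso_def homeomorphism_symD)

lemma smooth_isoI:
  assumes "open U" "open V" "smooth_on U f" "smooth_on V g"
    "\<And>x. x \<in> U \<Longrightarrow> f x \<in> V \<and> g (f x) = x" "\<And>y. y \<in> V \<Longrightarrow> g y \<in> U \<and> f (g y) = y"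
  shows "smooth_iso U V f g"
  unfolding smooth_iso_def using assms
  by (auto intro!: homeomorphismI smooth_on_imp_continuous_on)

lemma smooth_isoD:
  assumes "smooth_iso U V f g"
  shows "open U" "open V" "smooth_on U f" "smooth_on V g"
    "\<And>x. x \<in> U \<Longrightarrow> f x \<in> V" "\<And>x. x \<in> U \<Longrightarrow> g (f x) = x"
    "\<And>y. y \<in> V \<Longrightarrow> g y \<in> U" "\<And>y. y \<in> V \<Longrightarrow> f (g y) = y"
  using assms by (auto simp: smooth_iso_def homeomorphism_def)

lemma smooth_iso_restrict:
  assumes i: "smooth_iso U V f g" and "open W" "W \<subseteq> U"
  shows "smooth_iso W (f ` W) f g"
proof (rule smooth_isoI)
  note D = smooth_isoD[OF i]
  have "f ` W = V \<inter> g -` W"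
    using D(5-8) assms(3) by (fastforce intro: rev_image_eqI)
  then show "open (f ` W)"
    using continuous_open_preimage[OF smooth_on_imp_continuous_on[OF D(4)] D(2) assms(2)] by simp
  show "smooth_on W f" using D(3) assms(3) by (rule smooth_on_subset)
  show "smooth_on (f ` W) g" using D(4,5) assms(3) by (auto intro: smooth_on_subset)
qed (use assms smooth_isoD(6)[OF i] in auto)

lemma smooth_iso_compose:
  assumes "smooth_iso U V f g" "smooth_iso V W f' g'"
  shows "smooth_iso U W (\<lambda>x. f' (f x)) (\<lambda>x. g (g' x))"
proof (rule smooth_isoI)
  note D = smooth_isoD[OF assms(1)] smooth_isoD[OF assms(2)]
  show "smooth_on U (\<lambda>x. f' (f x))"
    using D by (intro smooth_on_compose[of U f V f']) auto
  show "smooth_on W (\<lambda>x. g (g' x))"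
    using D by (intro smooth_on_compose[of W g' V g]) auto
qed (use smooth_isoD[OF assms(1)] smooth_isoD[OF assms(2)] in auto)

lemma smooth_on_cong: "smooth_on S f \<Longrightarrow> (\<And>x. x \<in> S \<Longrightarrow> f x = g x) \<Longrightarrow> smooth_on S g"
  unfolding smooth_on_def by (metis IntD2)

lemma smooth_iso_imp_diffeomorphism:
  assumes "smooth_iso U V f g" shows "diffeomorphism_between U V f"
proof -
  note D = smooth_isoD[OF assms]
  have b: "bij_betw f U V" by (rule bij_betwI[of _ _ _ g]) (use D in auto)
  then have "inv_into U f y = g y" if "y \<in> V" for y
    using D that by (metis bij_betw_inv_into_left)
  then show ?thesis
    unfolding diffeomorphism_between_def using b D smooth_on_cong[OF D(4)] by metis
qed

lemma diffeomorphism_imp_smooth_iso: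
  assumes "diffeomorphism_between U V f" "open U" "open V"
  shows "smooth_iso U V f (inv_into U f)"
  using assms unfolding diffeomorphism_between_def
  by (intro smooth_isoI)
    (auto dest: bij_betwE bij_betw_inv_into simp: bij_betw_inv_into_left bij_betw_inv_into_right)

section \<open>Bijections that locally extend to ambient diffeomorphisms\<close>

text \<open>The last clause concerns all of U, not only its points in A: it makes f carry U \<inter>
  A onto V \<inter> B, which is what turns charts of A into charts of B. Extensions at different
  points of A need not agree off A.\<close>

definition ambient_diffeo ::
  "'a::euclidean_space set \<Rightarrow> 'a set \<Rightarrow> ('a \<Rightarrow> 'a) \<Rightarrow> bool" where
  "ambient_diffeo A B \<phi> \<longleftrightarrow> bij_betw \<phi> A B \<and>
     (\<forall>p\<in>A. \<exists>U V f g. p \<in> U \<and> smooth_iso U V f g \<and> (\<forall>y\<in>U \<inter> A. f y = \<phi> y) \<and>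
        (\<forall>y\<in>U. y \<in> A \<longleftrightarrow> f y \<in> B))"

lemma ambient_diffeoE:
  assumes "ambient_diffeo A B \<phi>" "p \<in> A"
  obtains U V f g where "p \<in> U" "smooth_iso U V f g" "\<And>y. y \<in> U \<inter> A \<Longrightarrow> f y = \<phi> y"
    "\<And>y. y \<in> U \<Longrightarrow> y \<in> A \<longleftrightarrow> f y \<in> B"
  using bspec[OF conjunct2[OF iffD1[OF ambient_diffeo_def assms(1)]] assms(2)] by blast

lemma ambient_diffeo_sym:
  assumes "ambient_diffeo A B \<phi>" shows "ambient_diffeo B A (inv_into A \<phi>)"
  unfolding ambient_diffeo_def
proof (intro conjI ballI)
  have b: "bij_betw \<phi> A B" using assms by (simp add: ambient_diffeo_def)
  then show "bij_betw (inv_into A \<phi>) B A" by (rule bij_betw_inv_into)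
  fix q assume "q \<in> B"
  then obtain p where p: "p \<in> A" "\<phi> p = q" using b by (auto simp: bij_betw_def)
  then obtain U V f g where f: "p \<in> U" "smooth_iso U V f g" "\<And>y. y \<in> U \<inter> A \<Longrightarrow> f y = \<phi> y"
    "\<And>y. y \<in> U \<Longrightarrow> y \<in> A \<longleftrightarrow> f y \<in> B"
    using ambient_diffeoE[OF assms p(1)] by metis
  note D = smooth_isoD[OF f(2)]
  have "g y \<in> A \<longleftrightarrow> y \<in> B" if "y \<in> V" for y
    using D(7,8)[OF that] f(4) by auto
  moreover have "g y = inv_into A \<phi> y" if "y \<in> V \<inter> B" for y
    using that D(7,8) f(3,4) b by (metis Int_iff bij_betw_inv_into_left)
  moreover have "q \<in> V" using D(5) f(1,3) p by force
  ultimately show "\<exists>U V f g. q \<in> U \<and> smooth_iso U V f g \<and> (\<forall>y\<in>U \<inter> B. f y = inv_into A \<phi> y) \<and>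
      (\<forall>y\<in>U. (y \<in> B) = (f y \<in> A))"
    using smooth_iso_sym[OF f(2)] by blast
qed

lemma ambient_diffeo_trans:
  assumes "ambient_diffeo A B \<phi>" "ambient_diffeo B C \<theta>"
  shows "ambient_diffeo A C (\<lambda>x. \<theta> (\<phi> x))"
  unfolding ambient_diffeo_def
proof (intro conjI ballI)
  have b: "bij_betw \<phi> A B" "bij_betw \<theta> B C" using assms by (auto simp: ambient_diffeo_def)
  then show "bij_betw (\<lambda>x. \<theta> (\<phi> x)) A C"
    using bij_betw_trans[OF b] by (simp add: o_def)
  fix p assume p: "p \<in> A"
  then obtain U V f g where f: "p \<in> U" "smooth_iso U V f g" "\<And>y. y \<in> U \<inter> A \<Longrightarrow> f y = \<phi> y"
    "\<And>y. y \<in> U \<Longrightarrow> y \<in> A \<longleftrightarrow> f y \<in> B"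
    using ambient_diffeoE[OF assms(1) p] by metis
  have "\<phi> p \<in> B" using b(1) p by (auto dest: bij_betwE)
  then obtain U' V' f' g' where f': "\<phi> p \<in> U'" "smooth_iso U' V' f' g'"
    "\<And>y. y \<in> U' \<inter> B \<Longrightarrow> f' y = \<theta> y" "\<And>y. y \<in> U' \<Longrightarrow> y \<in> B \<longleftrightarrow> f' y \<in> C"
    using ambient_diffeoE[OF assms(2)] by metis
  note D = smooth_isoD[OF f(2)] and D' = smooth_isoD[OF f'(2)]
  define W where "W = U \<inter> f -` U'"
  have W: "open W" "W \<subseteq> U"
    unfolding W_def using continuous_open_preimage[OF smooth_on_imp_continuous_on[OF D(3)] D(1) D'(1)] by auto
  have i: "smooth_iso W (f ` W) f g" by (rule smooth_iso_restrict[OF f(2) W])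
  have i': "smooth_iso (f ` W) (f' ` f ` W) f' g'"
    by (rule smooth_iso_restrict[OF f'(2)]) (use smooth_isoD(2)[OF i] in \<open>auto simp: W_def\<close>)
  have "p \<in> W" using f(1,3) f'(1) p by (simp add: W_def)
  moreover have "f' (f y) = \<theta> (\<phi> y)" if "y \<in> W \<inter> A" for y
    using that f(3)[of y] f(4)[of y] f'(3)[of "f y"] by (auto simp: W_def)
  moreover have "y \<in> A \<longleftrightarrow> f' (f y) \<in> C" if "y \<in> W" for y
    using that f(4) f'(4) by (auto simp: W_def)
  ultimately show "\<exists>U V f g. p \<in> U \<and> smooth_iso U V f g \<and> (\<forall>y\<in>U \<inter> A. f y = \<theta> (\<phi> y)) \<and>
      (\<forall>y\<in>U. (y \<in> A) = (f y \<in> C))"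
    using smooth_iso_compose[OF i i'] by blast
qed

lemma ambient_diffeo_imp_smooth_on:
  assumes "ambient_diffeo A B \<phi>" shows "smooth_on A \<phi>"
  using assms unfolding ambient_diffeo_def
  by (intro smooth_on_local) (metis smooth_isoD(1,3))

lemma ambient_diffeo_imp_diffeomorphism:
  assumes "ambient_diffeo A B \<phi>" shows "diffeomorphism_between A B \<phi>"
  using assms ambient_diffeo_imp_smooth_on ambient_diffeo_sym
  by (metis ambient_diffeo_def diffeomorphism_between_def)

text \<open>The new chart is \<psi> after g on the image of W, where the chart and the local
  extension are both defined; the numbering e of the coordinates is kept.\<close>

lemma mgb_at_ambient_diffeo:
  fixes A B :: "(real^'n) set"
  assumes \<phi>: "ambient_diffeo A B \<phi>" and p: "p \<in> A" and chart: "mgb_at A p q r"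
  shows "mgb_at B (\<phi> p) q r"
proof -
  have qr: "q + r \<le> CARD('n)" using chart by (simp add: mgb_at_def)
  define P where "P e v \<longleftrightarrow> (\<forall>i\<in>{1..q}. v $ e i = 0) \<and> (\<forall>i\<in>{q+1..q+r}. v $ e i \<ge> 0)"
    for e :: "nat \<Rightarrow> 'n" and v :: "real^'n"
  have "\<exists>U0 V0 \<psi> e. open U0 \<and> open V0 \<and> diffeomorphism_between U0 V0 \<psi> \<and> p \<in> U0 \<and> \<psi> p = 0 \<and>
        bij_betw e {1..CARD('n)} UNIV \<and> \<psi> ` (U0 \<inter> A) = {v \<in> V0. P e v}"
    using chart unfolding mgb_at_def P_def by (rule conjunct2)
  then obtain U0 V0 \<psi> e where C: "open U0 \<and> open V0 \<and> diffeomorphism_between U0 V0 \<psi> \<and> p \<in> U0 \<and> \<psi> p = 0 \<and>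
        bij_betw e {1..CARD('n)} UNIV \<and> \<psi> ` (U0 \<inter> A) = {v \<in> V0. P e v}"
    by (elim exE) (rule that)
  then have c: "open U0" "open V0" "diffeomorphism_between U0 V0 \<psi>" "p \<in> U0" "\<psi> p = 0"
      "bij_betw e {1..CARD('n)} UNIV" and im: "\<psi> ` (U0 \<inter> A) = {v \<in> V0. P e v}"
    by - (elim conjE, assumption)+
  obtain U V f g where f: "p \<in> U" "smooth_iso U V f g" "\<And>y. y \<in> U \<inter> A \<Longrightarrow> f y = \<phi> y"
    "\<And>y. y \<in> U \<Longrightarrow> y \<in> A \<longleftrightarrow> f y \<in> B"
    using ambient_diffeoE[OF \<phi> p] by metis
  note i0 = diffeomorphism_imp_smooth_iso[OF c(3,1,2)]
  note D = smooth_isoD[OF f(2)] and D0 = smooth_isoD[OF i0]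
  define W where "W = U \<inter> U0"
  have W: "open W" using c(1) D(1) by (auto simp: W_def)
  have i: "smooth_iso (f ` W) (\<psi> ` W) (\<lambda>y. \<psi> (g y)) (\<lambda>v. f (inv_into U0 \<psi> v))"
  proof (rule smooth_iso_compose[of "f ` W" W g f "\<psi> ` W" \<psi> "inv_into U0 \<psi>"])
    show "smooth_iso (f ` W) W g f"
      using smooth_iso_restrict[OF f(2) W] by (simp add: W_def smooth_iso_sym)
    show "smooth_iso W (\<psi> ` W) \<psi> (inv_into U0 \<psi>)"
      using smooth_iso_restrict[OF i0 W] by (simp add: W_def)
  qed
  \<comment> \<open>The chart condition is an equation between images of all of U0. Injectivity of
    \<psi> turns it into a pointwise criterion, which survives the restriction to W.\<close>
  have mem: "y \<in> A \<longleftrightarrow> P e (\<psi> y)" if "y \<in> U0" for y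
  proof
    assume "y \<in> A"
    then show "P e (\<psi> y)" using im that by blast
  next
    assume "P e (\<psi> y)"
    then have "\<psi> y \<in> \<psi> ` (U0 \<inter> A)" using im D0(5)[OF that] by simp
    then show "y \<in> A" using D0(6) that by (metis IntE imageE)
  qed
  have "(\<lambda>y. \<psi> (g y)) ` (f ` W \<inter> B) = {v \<in> \<psi> ` W. P e v}"
  proof (intro set_eqI iffI)
    fix v assume "v \<in> (\<lambda>y. \<psi> (g y)) ` (f ` W \<inter> B)"
    then obtain w where "w \<in> W" "f w \<in> B" "v = \<psi> (g (f w))" by auto
    then show "v \<in> {v \<in> \<psi> ` W. P e v}" using D(6) f(4) mem by (auto simp: W_def)
  next
    fix v assume "v \<in> {v \<in> \<psi> ` W. P e v}"
    then obtain w where w: "w \<in> W" "v = \<psi> w" "P e (\<psi> w)" by auto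
    then have "f w \<in> B" using f(4) mem by (auto simp: W_def)
    moreover have "v = \<psi> (g (f w))" using w D(6) by (auto simp: W_def)
    ultimately show "v \<in> (\<lambda>y. \<psi> (g y)) ` (f ` W \<inter> B)" using w(1) by blast
  qed
  moreover have "\<phi> p \<in> f ` W"
    using f(1) f(3)[of p] p c(4) by (intro image_eqI[of _ _ p]) (auto simp: W_def)
  moreover have "\<psi> (g (\<phi> p)) = 0"
    using f(1) f(3)[of p] p c(5) D(6)[of p] by auto
  ultimately show ?thesis
    unfolding mgb_at_def using qr c(6) smooth_iso_imp_diffeomorphism[OF i] smooth_isoD(1,2)[OF i]
    unfolding P_def by (intro conjI exI[of _ "f ` W"] exI[of _ "\<psi> ` W"] exI[of _ "\<lambda>y. \<psi> (g y)"] exI[of _ e])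
qed

text \<open>\<open>mgb_at\<close> asserts that some chart exists, so transporting charts along
  \<phi> gives one inclusion; the other transports them back along the inverse.\<close>

lemma Sigma_stratum_ambient_diffeo:
  assumes \<phi>: "ambient_diffeo A B \<phi>"
  shows "\<phi> ` Sigma_stratum s A l = Sigma_stratum s B l"
proof
  have b: "bij_betw \<phi> A B" using \<phi> by (simp add: ambient_diffeo_def)
  show "\<phi> ` Sigma_stratum s A l \<subseteq> Sigma_stratum s B l"
    using mgb_at_ambient_diffeo[OF \<phi>] b by (auto simp: Sigma_stratum_def dest: bij_betwE)
  show "Sigma_stratum s B l \<subseteq> \<phi> ` Sigma_stratum s A l"
  proof
    fix y assume y: "y \<in> Sigma_stratum s B l"
    then have "inv_into A \<phi> y \<in> Sigma_stratum s A l" "\<phi> (inv_into A \<phi> y) = y"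
      using mgb_at_ambient_diffeo[OF ambient_diffeo_sym[OF \<phi>]] b bij_betw_inv_into[OF b]
      by (auto simp: Sigma_stratum_def bij_betw_inv_into_right dest: bij_betwE)
    then show "y \<in> \<phi> ` Sigma_stratum s A l" by (metis imageI)
  qed
qed

lemma path_component_continuous_image:
  assumes "path_component T x y" "continuous_on T f"
  shows "path_component (f ` T) (f x) (f y)"
proof -
  obtain g where g: "path g" "path_image g \<subseteq> T" "pathstart g = x" "pathfinish g = y"
    using assms(1) by (auto simp: path_component_def)
  then have "path (f \<circ> g)"
    using assms(2) by (intro path_continuous_image continuous_on_subset[OF assms(2)])
  then show ?thesis
    using g unfolding path_component_def
    by (intro exI[of _ "f \<circ> g"]) (auto simp: path_image_compose pathstart_compose pathfinish_compose)
qed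

lemma path_component_set_homeomorphism:
  assumes "homeomorphism T T' f g" "x \<in> T"
  shows "f ` path_component_set T x = path_component_set T' (f x)"
proof (intro set_eqI iffI)
  note h = assms(1)[unfolded homeomorphism_def]
  fix y
  show "y \<in> f ` path_component_set T x \<Longrightarrow> y \<in> path_component_set T' (f x)"
    using path_component_continuous_image[of T x _ f] h by auto
  assume "y \<in> path_component_set T' (f x)"
  then have p: "path_component T' (f x) y" by simp
  have "path_component T x (g y)"
    using path_component_continuous_image[OF p, of g] h assms(2) by auto
  moreover have "f (g y) = y" using path_component_mem(2)[OF p] h by auto
  ultimately show "y \<in> f ` path_component_set T x" by (metis imageI mem_Collect_eq)
qed

lemma ambient_diffeo_stratification_preserving:
  assumes \<phi>: "ambient_diffeo A B \<phi>"
  shows "stratification_preserving s A B \<phi>"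
  unfolding stratification_preserving_def
proof
  fix S assume "S \<in> strata s A"
  then obtain l z where l: "l \<le> s" "z \<in> Sigma_stratum s A l"
    and S: "S = path_component_set (Sigma_stratum s A l) z"
    by (auto simp: strata_def)
  have b: "bij_betw \<phi> A B" using \<phi> by (simp add: ambient_diffeo_def)
  have sub: "Sigma_stratum s C l \<subseteq> C" for C :: "(real^'a) set"
    by (auto simp: Sigma_stratum_def)
  have "homeomorphism (Sigma_stratum s A l) (Sigma_stratum s B l) \<phi> (inv_into A \<phi>)"
  proof -
    have "homeomorphism A B \<phi> (inv_into A \<phi>)"
      using b smooth_on_imp_continuous_on[OF ambient_diffeo_imp_smooth_on[OF \<phi>]]
        smooth_on_imp_continuous_on[OF ambient_diffeo_imp_smooth_on[OF ambient_diffeo_sym[OF \<phi>]]]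
      by (intro homeomorphismI)
        (auto dest: bij_betwE bij_betw_inv_into simp: bij_betw_inv_into_left bij_betw_inv_into_right)
    then show ?thesis
      by (rule homeomorphism_of_subsets[OF _ sub sub[of B]])
        (rule Sigma_stratum_ambient_diffeo[OF \<phi>])
  qed
  then have "\<phi> ` S = path_component_set (Sigma_stratum s B l) (\<phi> z)"
    unfolding S using l(2) by (rule path_component_set_homeomorphism)
  moreover have "\<phi> z \<in> Sigma_stratum s B l"
    using l(2) Sigma_stratum_ambient_diffeo[OF \<phi>] by blast
  ultimately show "\<phi> ` S \<in> strata s B" using l(1) by (auto simp: strata_def)
qed

section \<open>Correspondences given by implicit equations\<close>

lemma smooth_on_bounded_linear: "bounded_linear L \<Longrightarrow> smooth_on UNIV L"
  by (simp add: smooth_on_iff_open Ck_on_bounded_linear)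

lemma smooth_local_inverse:
  fixes f :: "'a::euclidean_space \<Rightarrow> 'a"
  assumes W: "open W" "\<And>k. Ck_on k W f" "p \<in> W"
    and "(f has_derivative f') (at p)" "\<And>v. f' v = 0 \<Longrightarrow> v = 0"
  obtains U V g where "p \<in> U" "U \<subseteq> W" "smooth_iso U V f g"
proof -
  from smooth_inverse_function[OF assms]
  obtain U V g where U: "open U" "U \<subseteq> W" "p \<in> U" "open V" "homeomorphism U V f g"
    "\<And>k. Ck_on k V g" by blast
  then have "smooth_iso U V f g"
    unfolding smooth_iso_def using Ck_on_subset[OF W(2)] by (simp add: smooth_on_iff_open)
  then show ?thesis using that U by blast
qed

text \<open>Reduces the implicit to the inverse function theorem: adjoining x and P w as parameters
  makes domain and codomain the same space. P is left open so that y and z can each take the role of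
  the given variable.\<close>

lemma smooth_inverse_chart:
  fixes E :: "'x::euclidean_space \<times> 'a::euclidean_space \<times> 'a \<times> 's::euclidean_space \<Rightarrow> 'a \<times> 's"
    and P :: "'x \<times> 'a \<times> 'a \<times> 's \<Rightarrow> 'a"
  assumes W: "open W" "\<And>k. Ck_on k W E" "p \<in> W" and E': "(E has_derivative E') (at p)"
    and P: "bounded_linear P"
    and ker: "\<And>w. fst w = 0 \<Longrightarrow> P w = 0 \<Longrightarrow> E' w = 0 \<Longrightarrow> w = 0"
  obtains N V G where "p \<in> N" "N \<subseteq> W" "smooth_iso N V (\<lambda>w. (fst w, P w, E w)) G"
proof -
  have Ck: "Ck_on k W (\<lambda>w. (fst w, P w, E w))" for k
    by (intro Ck_on_Pair Ck_on_bounded_linear[OF bounded_linear_fst] Ck_on_bounded_linear[OF P] W)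
  have der: "((\<lambda>w. (fst w, P w, E w)) has_derivative (\<lambda>w. (fst w, P w, E' w))) (at p)"
    by (intro has_derivative_Pair bounded_linear_imp_has_derivative bounded_linear_fst P E')
  have ker': "w = 0" if "(fst w, P w, E' w) = 0" for w
    using ker that by (simp add: zero_prod_def)
  show ?thesis
    by (rule smooth_local_inverse[OF W(1) Ck W(3) der]) (use ker' that in blast)+
qed

text \<open>Near p the zero set of E is a graph over (x, y) and also over (x, z), so for fixed x the
  two solution maps are mutually inverse. U and V may be empty; solutions are supplied by the
  openness clauses, which hold because the zeros in M correspond to the points (x, y, 0) in the open
  image of M under F1, and likewise for F2. Arbitrary open M are allowed so that solutions can later
  be forced to be small.\<close>

lemma implicit_correspondence:
  fixes E :: "'x::euclidean_space \<times> 'a::euclidean_space \<times> 'a \<times> 's::euclidean_space \<Rightarrow> 'a \<times> 's"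
  assumes W: "open W" "\<And>k. Ck_on k W E" "p \<in> W" and E': "(E has_derivative E') (at p)"
    and ker1: "\<And>u s. E' (0, 0, u, s) = 0 \<Longrightarrow> u = 0 \<and> s = 0"
    and ker2: "\<And>u s. E' (0, u, 0, s) = 0 \<Longrightarrow> u = 0 \<and> s = 0"
  obtains N where "open N" "p \<in> N" "N \<subseteq> W"
    "\<forall>x. \<exists>U V f g. smooth_iso U V f g \<and>
        (\<forall>y z. (\<exists>s. (x, y, z, s) \<in> N \<and> E (x, y, z, s) = 0) \<longleftrightarrow> y \<in> U \<and> z = f y)"
    "\<forall>M. open M \<longrightarrow> M \<subseteq> N \<longrightarrow> open {(x, y). \<exists>z s. (x, y, z, s) \<in> M \<and> E (x, y, z, s) = 0}"
    "\<forall>M. open M \<longrightarrow> M \<subseteq> N \<longrightarrow> open {(x, z). \<exists>y s. (x, y, z, s) \<in> M \<and> E (x, y, z, s) = 0}"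
proof -
  define P :: "'x \<times> 'a \<times> 'a \<times> 's \<Rightarrow> 'a" where "P w = fst (snd w)" for w
  define Q :: "'x \<times> 'a \<times> 'a \<times> 's \<Rightarrow> 'a" where "Q w = fst (snd (snd w))" for w
  have lin: "bounded_linear P" "bounded_linear Q"
    unfolding P_def[abs_def] Q_def[abs_def]
    by (intro bounded_linear_fst_comp bounded_linear_snd_comp bounded_linear_ident)+
  have k1: "w = 0" if "fst w = 0" "P w = 0" "E' w = 0" for w
    using that ker1 by (cases w) (auto simp: P_def zero_prod_def)
  have k2: "w = 0" if "fst w = 0" "Q w = 0" "E' w = 0" for w
    using that ker2 by (cases w) (auto simp: Q_def zero_prod_def)
  obtain N1 V1 G1 where 1: "p \<in> N1" "N1 \<subseteq> W" "smooth_iso N1 V1 (\<lambda>w. (fst w, P w, E w)) G1"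
    by (rule smooth_inverse_chart[OF W E' lin(1) k1])
  obtain N2 V2 G2 where 2: "p \<in> N2" "N2 \<subseteq> W" "smooth_iso N2 V2 (\<lambda>w. (fst w, Q w, E w)) G2"
    by (rule smooth_inverse_chart[OF W E' lin(2) k2])
  define N where "N = N1 \<inter> N2"
  have N: "open N" "p \<in> N" "N \<subseteq> W" "N \<subseteq> N1" "N \<subseteq> N2"
    using 1 2 smooth_isoD(1)[OF 1(3)] smooth_isoD(1)[OF 2(3)] by (auto simp: N_def)
  define F1 where "F1 w = (fst w, P w, E w)" for w
  define F2 where "F2 w = (fst w, Q w, E w)" for w
  have i1: "smooth_iso M (F1 ` M) F1 G1" if "open M" "M \<subseteq> N" for M
    unfolding F1_def[abs_def] by (rule smooth_iso_restrict[OF 1(3) that(1)]) (use that N in auto)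
  have i2: "smooth_iso M (F2 ` M) F2 G2" if "open M" "M \<subseteq> N" for M
    unfolding F2_def[abs_def] by (rule smooth_iso_restrict[OF 2(3) that(1)]) (use that N in auto)
  note D1 = smooth_isoD[OF i1[OF N(1) order_refl]] and D2 = smooth_isoD[OF i2[OF N(1) order_refl]]
  show ?thesis
  proof (rule that[OF N(1-3)]; intro allI impI)
    fix x
    define U where "U = {y. (x, y, 0) \<in> F1 ` N}"
    define V where "V = {z. (x, z, 0) \<in> F2 ` N}"
    define f where "f y = Q (G1 (x, y, 0))" for y
    define g where "g z = P (G2 (x, z, 0))" for z
    have sm: "smooth_on UNIV (\<lambda>y::'a. (x, y, 0::'a \<times> 's))"
      by (auto simp: smooth_on_iff_open intro!: Ck_on_Pair Ck_on_const Ck_on_bounded_linear[OF bounded_linear_ident])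
    have o: "open {y::'a. (x, y, 0::'a\<times>'s) \<in> T}" if "open T" for T
      using continuous_open_preimage[OF smooth_on_imp_continuous_on[OF sm] open_UNIV that]
      by (simp add: vimage_def)
    have U: "\<exists>s. (x, y, f y, s) \<in> N \<and> E (x, y, f y, s) = 0 \<and> G1 (x, y, 0) = (x, y, f y, s)" if y: "y \<in> U" for y
    proof -
      have "F1 (G1 (x, y, 0)) = (x, y, 0)" "G1 (x, y, 0) \<in> N"
        using y D1(7,8)[of "(x, y, 0)"] by (auto simp: U_def)
      then show ?thesis
        by (intro exI[of _ "snd (snd (snd (G1 (x, y, 0))))"])
          (cases "G1 (x, y, 0)", auto simp: F1_def P_def Q_def f_def)
    qed
    have V: "\<exists>s. (x, g z, z, s) \<in> N \<and> E (x, g z, z, s) = 0" if z: "z \<in> V" for z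
    proof -
      have "F2 (G2 (x, z, 0)) = (x, z, 0)" "G2 (x, z, 0) \<in> N"
        using z D2(7,8)[of "(x, z, 0)"] by (auto simp: V_def)
      then show ?thesis
        by (intro exI[of _ "snd (snd (snd (G2 (x, z, 0))))"])
          (cases "G2 (x, z, 0)", auto simp: F2_def P_def Q_def g_def)
    qed
    have UV: "y \<in> U \<and> z \<in> V \<and> z = f y \<and> y = g z" if w: "(x, y, z, s) \<in> N" "E (x, y, z, s) = 0" for y z s
    proof -
      have "F1 (x, y, z, s) = (x, y, 0)" "F2 (x, y, z, s) = (x, z, 0)"
        using w by (auto simp: F1_def F2_def P_def Q_def)
      then show ?thesis
        using D1(6)[OF w(1)] D2(6)[OF w(1)] imageI[OF w(1), of F1] imageI[OF w(1), of F2]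
        by (simp add: U_def V_def f_def g_def P_def Q_def)
    qed
    have "smooth_iso U V f g"
    proof (rule smooth_isoI)
      show "open U" "open V" unfolding U_def V_def using o D1(2) D2(2) by auto
      show "smooth_on U f" unfolding f_def
        by (intro smooth_on_compose[OF _ smooth_on_bounded_linear[OF lin(2)]]
              smooth_on_compose[OF smooth_on_subset[OF sm] D1(4)]) (auto simp: U_def)
      show "smooth_on V g" unfolding g_def
        by (intro smooth_on_compose[OF _ smooth_on_bounded_linear[OF lin(1)]]
              smooth_on_compose[OF smooth_on_subset[OF sm] D2(4)]) (auto simp: V_def)
    qed (use U V UV in metis)+
    moreover have "(\<exists>s. (x, y, z, s) \<in> N \<and> E (x, y, z, s) = 0) \<longleftrightarrow> y \<in> U \<and> z = f y" for y z
      using U UV by metis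
    ultimately show "\<exists>U V f g. smooth_iso U V f g \<and>
        (\<forall>y z. (\<exists>s. (x, y, z, s) \<in> N \<and> E (x, y, z, s) = 0) \<longleftrightarrow> y \<in> U \<and> z = f y)"
      by blast
  next
    fix M assume M: "open M" "M \<subseteq> N"
    have "continuous_on UNIV (\<lambda>q. (fst q :: 'x, snd q :: 'a, 0 :: 'a \<times> 's))"
      by (intro continuous_intros)
    then have o: "open {q. (fst q, snd q, 0) \<in> T}" if "open T" for T :: "('x \<times> 'a \<times> 'a \<times> 's) set"
      using continuous_open_preimage[OF _ open_UNIV that] by (simp add: vimage_def)
    have "{(x, y). \<exists>z s. (x, y, z, s) \<in> M \<and> E (x, y, z, s) = 0} = {q. (fst q, snd q, 0) \<in> F1 ` M}"
      by (force simp: F1_def P_def image_iff)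
    then show "open {(x, y). \<exists>z s. (x, y, z, s) \<in> M \<and> E (x, y, z, s) = 0}"
      using o smooth_isoD(2)[OF i1[OF M]] by simp
    have "{(x, z). \<exists>y s. (x, y, z, s) \<in> M \<and> E (x, y, z, s) = 0} = {q. (fst q, snd q, 0) \<in> F2 ` M}"
      by (force simp: F2_def Q_def image_iff)
    then show "open {(x, z). \<exists>y s. (x, y, z, s) \<in> M \<and> E (x, y, z, s) = 0}"
      using o smooth_isoD(2)[OF i2[OF M]] by simp
  qed
qed

section \<open>Correction along the constraint gradients: local theory\<close>

lemma inner_sum_inj_Basis:
  assumes "finite J" "inj_on e J" "e ` J \<subseteq> Basis" "j \<in> J"
  shows "(\<Sum>i\<in>J. c i *\<^sub>R e i) \<bullet> e j = (c j :: real)"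
proof -
  have "(\<Sum>i\<in>J. c i *\<^sub>R e i) \<bullet> e j = (\<Sum>i\<in>J. if i = j then c i else 0)"
    unfolding inner_sum_left
    using assms(2-4) by (intro sum.cong) (auto simp: inner_Basis image_subset_iff inj_on_eq_iff)
  then show ?thesis using assms(1,4) by simp
qed

text \<open>The active coefficients are the numbers s \<bullet> e j. Taking the inner product of the
  last hypothesis with e j cancels them and leaves a j \<bullet> d = 0 for active j. In d \<bullet>
  d only inactive terms remain, each a square divided by c i < 0, so d = 0. Independence then kills
  the active coefficients, and the last hypothesis reduces to s = 0.\<close>

lemma active_gradients_kernel:
  fixes a :: "'i \<Rightarrow> 'a::euclidean_space"
  assumes I: "finite I" "J \<subseteq> I" and e: "inj_on e J" "e ` J \<subseteq> Basis"
    and a: "inj_on a J" "independent (a ` J)" and c: "\<And>i. i \<in> I - J \<Longrightarrow> c i < 0"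
    and d: "d = (\<Sum>i\<in>I. (if i \<in> J then s \<bullet> e i else (a i \<bullet> d) / c i) *\<^sub>R a i)"
    and s: "s + (\<Sum>j\<in>J. (a j \<bullet> d - s \<bullet> e j) *\<^sub>R e j) = 0"
  shows "d = 0 \<and> s = 0"
proof -
  have J: "finite J" using I by (rule finite_subset[rotated])
  have ad: "a j \<bullet> d = 0" if "j \<in> J" for j
  proof -
    have "(s + (\<Sum>j\<in>J. (a j \<bullet> d - s \<bullet> e j) *\<^sub>R e j)) \<bullet> e j = 0" using s by simp
    then show ?thesis by (simp add: inner_add_left inner_sum_inj_Basis[OF J e that])
  qed
  have "d \<bullet> d = (\<Sum>i\<in>I. (if i \<in> J then s \<bullet> e i else (a i \<bullet> d) / c i) * (a i \<bullet> d))"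
    by (subst (1) d) (simp add: inner_sum_left)
  also have "\<dots> \<le> 0"
  proof (rule sum_nonpos)
    fix i assume "i \<in> I"
    then show "(if i \<in> J then s \<bullet> e i else (a i \<bullet> d) / c i) * (a i \<bullet> d) \<le> 0"
      using ad c[of i] by (auto simp: divide_nonneg_neg)
  qed
  finally have d0: "d = 0" by (metis antisym inner_eq_zero_iff inner_ge_zero)
  then have "(\<Sum>i\<in>I. (if i \<in> J then s \<bullet> e i else 0) *\<^sub>R a i) = 0"
    using d by (simp cong: if_cong)
  also have "(\<Sum>i\<in>I. (if i \<in> J then s \<bullet> e i else 0) *\<^sub>R a i) = (\<Sum>j\<in>J. (s \<bullet> e j) *\<^sub>R a j)"
    using I by (intro sum.mono_neutral_cong_right) auto
  also have "\<dots> = (\<Sum>v\<in>a ` J. (s \<bullet> e (inv_into J a v)) *\<^sub>R v)"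
    using a(1) by (simp add: sum.reindex inv_into_f_f)
  finally have "s \<bullet> e (inv_into J a v) = 0" if "v \<in> a ` J" for v
    using independentD[OF a(2) _ order_refl _ that, of "\<lambda>v. s \<bullet> e (inv_into J a v)"] J by blast
  then have "s \<bullet> e j = 0" if "j \<in> J" for j
    using that a(1) by (metis image_eqI inv_into_f_f)
  then show ?thesis using s d0 by simp
qed

lemma open_Collect_abs_less:
  fixes T :: "'i \<Rightarrow> 'a::topological_space \<Rightarrow> real"
  assumes "finite I" "open W" "\<And>i. i \<in> I \<Longrightarrow> continuous_on W (T i)"
  shows "open {w \<in> W. \<forall>i\<in>I. \<bar>T i w\<bar> < \<epsilon>}"
proof -
  have "open (W \<inter> (\<Inter>i\<in>I. W \<inter> T i -` {- \<epsilon> <..< \<epsilon>}))"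
    using assms by (intro open_Int open_INT ballI continuous_open_preimage) auto
  also have "W \<inter> (\<Inter>i\<in>I. W \<inter> T i -` {- \<epsilon> <..< \<epsilon>}) = {w \<in> W. \<forall>i\<in>I. \<bar>T i w\<bar> < \<epsilon>}"
    by (auto simp: abs_less_iff)
  finally show ?thesis .
qed

text \<open>Using the coefficients of the displacement also as the relative changes of the constraints
  makes the linearised system regular: up to a diagonal of slacks its matrix is the Gram matrix of
  the gradients \<open>a i y\<close>.\<close>

definition normal_shift ::
  "nat set \<Rightarrow> (nat \<Rightarrow> 'x \<Rightarrow> 'a \<Rightarrow> real) \<Rightarrow> (nat \<Rightarrow> 'a \<Rightarrow> 'a::euclidean_space) \<Rightarrow> 'x \<Rightarrow> 'x \<Rightarrow> real \<Rightarrow> 'a \<Rightarrow> 'a \<Rightarrow> bool" where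
  "normal_shift I h a x0 x \<epsilon> y z \<longleftrightarrow> norm (z - y) < \<epsilon> \<and>
     (\<exists>t. (\<forall>i\<in>I. \<bar>t i\<bar> < \<epsilon> \<and> h i x z = (1 + t i) * h i x0 y) \<and> z = y + (\<Sum>i\<in>I. t i *\<^sub>R a i y))"

text \<open>Uniqueness and existence are separated: shifts of size \<delta> starting near y0 lie on
  the graph of one diffeomorphism, while shifts of any prescribed size \<epsilon> exist near y0,
  with y as start or as end. A finite cover has to fix all radii \<delta> before a common \<epsilon>
  is chosen. H extends h to a neighbourhood of (x0, y0), since X need not be open.\<close>

lemma local_normal_shift:
  fixes H :: "nat \<Rightarrow> 'x::euclidean_space \<times> 'a::euclidean_space \<Rightarrow> real"
    and h :: "nat \<Rightarrow> 'x \<Rightarrow> 'a \<Rightarrow> real"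
  assumes I: "finite I" and W: "open W" "(x0, y0) \<in> W" and x0: "x0 \<in> X"
    and H: "\<And>i k. i \<in> I \<Longrightarrow> Ck_on k W (H i)"
    and Hh: "\<And>i x y. i \<in> I \<Longrightarrow> x \<in> X \<Longrightarrow> (x, y) \<in> W \<Longrightarrow> H i (x, y) = h i x y"
    and u: "\<And>i k. i \<in> I \<Longrightarrow> Ck_on k UNIV (h i x0)"
    and a: "\<And>i k. i \<in> I \<Longrightarrow> Ck_on k UNIV (a i)"
    and du: "\<And>i. i \<in> I \<Longrightarrow> (h i x0 has_derivative (\<lambda>v. a i y0 \<bullet> v)) (at y0)"
    and neg: "\<And>i. i \<in> I \<Longrightarrow> h i x0 y0 \<le> 0" and J: "J = {i \<in> I. h i x0 y0 = 0}"
    and licq: "inj_on (\<lambda>i. a i y0) J" "independent ((\<lambda>i. a i y0) ` J)"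
  obtains \<delta> where "\<delta> > 0"
    "\<forall>x\<in>X. dist x x0 < \<delta> \<longrightarrow> (\<exists>U V f g. smooth_iso U V f g \<and>
       (\<forall>y\<in>ball y0 \<delta>. \<forall>z. normal_shift I h a x0 x \<delta> y z \<longrightarrow> y \<in> U \<and> z = f y) \<and>
       (\<forall>y\<in>U. \<forall>i\<in>I. h i x0 y \<le> 0 \<longleftrightarrow> h i x (f y) \<le> 0))"
    "\<forall>\<epsilon>>0. \<exists>\<eta>>0. \<forall>x\<in>X. \<forall>y. dist x x0 < \<eta> \<longrightarrow> dist y y0 < \<eta> \<longrightarrow>
       (\<exists>z. normal_shift I h a x0 x \<epsilon> y z) \<and> (\<exists>w. normal_shift I h a x0 x \<epsilon> w y)"
proof -
  have JI: "J \<subseteq> I" "finite J" using I by (auto simp: J)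
  have neg': "h i x0 y0 < 0" if "i \<in> I - J" for i
    using neg[of i] that by (auto simp: J)
  have "card ((\<lambda>i. a i y0) ` J) \<le> DIM('a)"
    using independent_bound[OF licq(2)] by simp
  then have "card J \<le> card (Basis :: 'a set)"
    using licq(1) by (simp add: card_image)
  then obtain e where e: "inj_on e J" "e ` J \<subseteq> (Basis :: 'a set)"
    using JI(2) by (metis card_le_inj finite_Basis)
  define py :: "'x \<times> 'a \<times> 'a \<times> 'a \<Rightarrow> 'a" where "py w = fst (snd w)" for w
  define pz :: "'x \<times> 'a \<times> 'a \<times> 'a \<Rightarrow> 'a" where "pz w = fst (snd (snd w))" for w
  define ps :: "'x \<times> 'a \<times> 'a \<times> 'a \<Rightarrow> 'a" where "ps w = snd (snd (snd w))" for w
  have lin: "bounded_linear py" "bounded_linear pz" "bounded_linear ps"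
    unfolding py_def[abs_def] pz_def[abs_def] ps_def[abs_def]
    by (intro bounded_linear_fst_comp bounded_linear_snd_comp bounded_linear_ident)+
  \<comment> \<open>Only the coefficients of the active constraints are unknowns; they are stored as the components
    of \<open>ps w\<close> along distinct basis vectors \<open>e j\<close>. The others are solved for explicitly.\<close>
  define T where "T i w = (if i \<in> J then ps w \<bullet> e i
      else H i (fst w, pz w) * inverse (h i x0 (py w)) - 1)" for i w
  \<comment> \<open>In the second entry the components along the e j are the active equations, as
    \<open>ps w \<bullet> e j\<close> cancels there. All other components force ps w into the span
    of the e j, so equations and unknowns are equal in number although card J varies with
    y0.\<close>
  define E where "E w = (pz w - py w - (\<Sum>i\<in>I. T i w *\<^sub>R a i (py w)),
      ps w + (\<Sum>j\<in>J. (H j (fst w, pz w) - (1 + ps w \<bullet> e j) * h j x0 (py w) - ps w \<bullet> e j) *\<^sub>R e j))" for w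
  define p where "p = (x0, y0, y0, 0::'a)"
  have p: "fst p = x0" "py p = y0" "pz p = y0" "ps p = 0"
    by (simp_all add: p_def py_def pz_def ps_def)
  define O0 where "O0 = (\<lambda>w. (fst w, pz w)) -` W \<inter> (\<Inter>i\<in>I-J. (\<lambda>w. h i x0 (py w)) -` (- {0}))"
  have cpy: "Ck_on k S (\<lambda>w. v (py w))" if "open S" "\<And>k. Ck_on k UNIV v"
    for k S and v :: "'a \<Rightarrow> 'c::euclidean_space"
    using that by (intro Ck_on_compose[of S UNIV k py v] Ck_on_bounded_linear[OF lin(1)]) auto
  have O0: "open O0" unfolding O0_def
  proof (intro open_Int open_INT ballI)
    have "continuous_on UNIV (\<lambda>w. (fst w, pz w))"
      using lin(2) by (intro continuous_intros linear_continuous_on)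
    then show "open ((\<lambda>w. (fst w, pz w)) -` W)" by (rule open_vimage[OF W(1)])
    show "open ((\<lambda>w. h i x0 (py w)) -` (- {0}))" if "i \<in> I - J" for i
    proof -
      have "Ck_on 0 UNIV (\<lambda>w. h i x0 (py w))" using that by (intro cpy u) auto
      then show ?thesis by (intro open_vimage) auto
    qed
  qed (use I in simp)
  have pO0: "p \<in> O0" using W(2) neg' p unfolding O0_def by fastforce
  have cH: "Ck_on k O0 (\<lambda>w. H i (fst w, pz w))" if "i \<in> I" for i k
    by (rule Ck_on_compose[OF O0 W(1) _ H[OF that]])
      (auto simp: O0_def[symmetric] intro!: Ck_on_Pair Ck_on_bounded_linear[OF bounded_linear_fst] Ck_on_bounded_linear[OF lin(2)] O0,
       auto simp: O0_def)
  have cT: "Ck_on k O0 (T i)" if i: "i \<in> I" for i k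
  proof (cases "i \<in> J")
    case True
    then show ?thesis unfolding T_def[abs_def]
      by (simp add: Ck_on_inner Ck_on_const Ck_on_bounded_linear[OF lin(3)] O0)
  next
    case False
    have "Ck_on k O0 (\<lambda>w. H i (fst w, pz w) * inverse (h i x0 (py w)) + (-1))"
      using i False
      by (intro Ck_on_add Ck_on_mult Ck_on_inverse cH cpy u Ck_on_const O0) (auto simp: O0_def)
    then show ?thesis using False by (simp add: T_def[abs_def])
  qed
  have cE: "Ck_on k O0 E" for k
  proof -
    have "Ck_on k O0 (\<lambda>w. (pz w + (-1) *\<^sub>R (py w + (\<Sum>i\<in>I. T i w *\<^sub>R a i (py w))),
      ps w + (\<Sum>j\<in>J. (H j (fst w, pz w) + (-1) * ((1 + ps w \<bullet> e j) * h j x0 (py w) + ps w \<bullet> e j)) *\<^sub>R e j)))"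
      using JI
      by (intro Ck_on_Pair Ck_on_add Ck_on_sum Ck_on_scaleR Ck_on_mult Ck_on_inner Ck_on_const cT cH
          cpy u a O0 Ck_on_bounded_linear lin) auto
    then show ?thesis by (simp add: E_def[abs_def] algebra_simps)
  qed
  define H' where "H' i = frechet_derivative (H i) (at (x0, y0))" for i
  have dH: "(H i has_derivative H' i) (at (x0, y0))" if "i \<in> I" for i
    unfolding H'_def using Ck_on_Suc_has_derivative[OF H[OF that] W(2)] .
  \<comment> \<open>H i agrees with h i only over X, which may leave its derivative in x
    undetermined. The slice at x0 lies over X, so the y-part is determined, and the kernels below
    involve nothing else.\<close>
  have H'0: "H' i (0, v) = a i y0 \<bullet> v" if i: "i \<in> I" for i v
  proof -
    have "((\<lambda>y. H i (x0, y)) has_derivative (\<lambda>v. H' i (0, v))) (at y0)"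
      by (rule has_derivative_compose[of "Pair x0" _ _ _ "H i"])
        (auto intro!: derivative_eq_intros dH[OF i])
    moreover have "open {y. (x0, y) \<in> W}"
      using open_vimage[OF W(1), of "Pair x0"] by (simp add: vimage_def continuous_on_Pair)
    ultimately have "(h i x0 has_derivative (\<lambda>v. H' i (0, v))) (at y0)"
      using has_derivative_transform_within_open[of _ _ _ UNIV "{y. (x0, y) \<in> W}" "h i x0"] W(2) Hh[OF i x0] by simp
    then show ?thesis using has_derivative_unique[OF _ du[OF i]] by metis
  qed
  have dpy: "(py has_derivative py) (at q)" "(pz has_derivative pz) (at q)" "(ps has_derivative ps) (at q)"
    "(fst has_derivative fst) (at q)" for q
    by (intro bounded_linear_imp_has_derivative lin bounded_linear_fst)+
  have dHp: "((\<lambda>w. H i (fst w, pz w)) has_derivative (\<lambda>d. H' i (fst d, pz d))) (at p)" if "i \<in> I" for i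
    by (rule has_derivative_compose[of "\<lambda>w. (fst w, pz w)" _ _ _ "H i"])
      (use dH[OF that] in \<open>auto simp: p intro!: has_derivative_Pair dpy\<close>)
  have dup: "((\<lambda>w. h i x0 (py w)) has_derivative (\<lambda>d. a i y0 \<bullet> py d)) (at p)" if "i \<in> I" for i
    by (rule has_derivative_compose[OF dpy(1), of "h i x0"]) (use du[OF that] in \<open>simp add: p\<close>)
  define T' where "T' i d = (if i \<in> J then ps d \<bullet> e i
      else (H' i (fst d, pz d) - a i y0 \<bullet> py d) / h i x0 y0)" for i d
  have Hp: "H i (x0, y0) = h i x0 y0" if "i \<in> I" for i using Hh[OF that x0 W(2)] .
  have Tp: "T i p = 0" if "i \<in> I" for i
    using neg'[of i] that by (auto simp: T_def p Hp)
  have dT: "(T i has_derivative T' i) (at p)" if i: "i \<in> I" for i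
  proof (cases "i \<in> J")
    case True
    have "((\<lambda>w. ps w \<bullet> e i) has_derivative (\<lambda>d. ps d \<bullet> e i)) (at p)"
      by (intro bounded_linear_imp_has_derivative bounded_linear_inner_left_comp lin)
    then show ?thesis using True by (simp add: T_def[abs_def] T'_def[abs_def])
  next
    case False
    then have n: "h i x0 y0 \<noteq> 0" using neg'[of i] i by auto
    have "((\<lambda>w. H i (fst w, pz w) * inverse (h i x0 (py w)) - 1) has_derivative
        (\<lambda>d. h i x0 y0 * - (inverse (h i x0 y0) * (a i y0 \<bullet> py d) * inverse (h i x0 y0)) +
           H' i (fst d, pz d) * inverse (h i x0 y0) - 0)) (at p)"
      using has_derivative_diff[OF has_derivative_mult[OF dHp[OF i]
            Deriv.has_derivative_inverse[OF _ dup[OF i]]] has_derivative_const[of 1]] n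
      by (simp add: p Hp[OF i])
    moreover have "(\<lambda>d. h i x0 y0 * - (inverse (h i x0 y0) * (a i y0 \<bullet> py d) * inverse (h i x0 y0)) +
           H' i (fst d, pz d) * inverse (h i x0 y0) - 0) = T' i"
      using False n by (auto simp: T'_def field_simps)
    ultimately show ?thesis using False by (simp add: T_def[abs_def])
  qed
  define E' where "E' d = (pz d - py d - (\<Sum>i\<in>I. T' i d *\<^sub>R a i y0),
      ps d + (\<Sum>j\<in>J. (H' j (fst d, pz d) - a j y0 \<bullet> py d - ps d \<bullet> e j) *\<^sub>R e j))" for d
  have dE: "(E has_derivative E') (at p)"
    unfolding E_def[abs_def] E'_def[abs_def]
  proof (intro has_derivative_Pair has_derivative_diff has_derivative_add has_derivative_sum dpy
      has_derivative_scaleR_left)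
    fix i assume i: "i \<in> I"
    have "isCont (\<lambda>w. a i (py w)) p"
      using cpy[of UNIV "a i" 0] a[OF i] by (simp add: continuous_on_eq_continuous_at p_def)
    from has_derivative_scaleR_vanishing[OF dT[OF i] Tp[OF i] this]
    show "((\<lambda>w. T i w *\<^sub>R a i (py w)) has_derivative (\<lambda>d. T' i d *\<^sub>R a i y0)) (at p)"
      by (simp add: p)
  next
    fix j assume j: "j \<in> J"
    then have jI: "j \<in> I" using JI by auto
    show "((\<lambda>w. H j (fst w, pz w)) has_derivative (\<lambda>d. H' j (fst d, pz d))) (at p)"
      by (rule dHp[OF jI])
    show ps: "((\<lambda>w. ps w \<bullet> e j) has_derivative (\<lambda>d. ps d \<bullet> e j)) (at p)"
      by (intro bounded_linear_imp_has_derivative bounded_linear_inner_left_comp lin)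
    \<comment> \<open>The factor h j x0 y0 of \<open>ps d \<bullet> e j\<close> is zero for active
      j, so the unknown coefficient drops out of the linearised active equation.\<close>
    have "((\<lambda>w. (1 + ps w \<bullet> e j) * h j x0 (py w)) has_derivative
        (\<lambda>d. (1 + ps p \<bullet> e j) * (a j y0 \<bullet> py d) + (0 + ps d \<bullet> e j) * h j x0 (py p))) (at p)"
      by (intro has_derivative_mult has_derivative_add has_derivative_const ps dup[OF jI])
    then show "((\<lambda>w. (1 + ps w \<bullet> e j) * h j x0 (py w)) has_derivative (\<lambda>d. a j y0 \<bullet> py d)) (at p)"
      using j by (simp add: p J)
  qed
  have ker: "d = 0 \<and> s = 0"
    if "d = (\<Sum>i\<in>I. (if i \<in> J then s \<bullet> e i else (a i y0 \<bullet> d) / h i x0 y0) *\<^sub>R a i y0)"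
      "s + (\<Sum>j\<in>J. (a j y0 \<bullet> d - s \<bullet> e j) *\<^sub>R e j) = 0" for d s
    using active_gradients_kernel[OF I JI(1) e licq neg' that] .
  have ker1: "d = 0 \<and> s = 0" if "E' (0, 0, d, s) = 0" for d s
  proof (rule ker)
    have "T' i (0, 0, d, s) = (if i \<in> J then s \<bullet> e i else (a i y0 \<bullet> d) / h i x0 y0)" if "i \<in> I" for i
      using that by (simp add: T'_def py_def pz_def ps_def H'0)
    then show "d = (\<Sum>i\<in>I. (if i \<in> J then s \<bullet> e i else (a i y0 \<bullet> d) / h i x0 y0) *\<^sub>R a i y0)"
      using that by (simp add: E'_def zero_prod_def py_def pz_def cong: sum.cong)
    have "H' j (0, d) = a j y0 \<bullet> d" if "j \<in> J" for j using that JI H'0 by blast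
    then show "s + (\<Sum>j\<in>J. (a j y0 \<bullet> d - s \<bullet> e j) *\<^sub>R e j) = 0"
      using that by (simp add: E'_def zero_prod_def py_def pz_def ps_def cong: sum.cong)
  qed
  \<comment> \<open>With x fixed, the derivative at p sees the variations of y and z only through
    their difference, so varying y alone is the case of \<open>ker\<close> with - d.\<close>
  have ker2: "d = 0 \<and> s = 0" if "E' (0, d, 0, s) = 0" for d s
  proof -
    have "- d = 0 \<and> s = 0"
    proof (rule ker)
      have "T' i (0, d, 0, s) = (if i \<in> J then s \<bullet> e i else (a i y0 \<bullet> - d) / h i x0 y0)" if "i \<in> I" for i
        using H'0[OF that, of 0] by (simp add: T'_def py_def pz_def ps_def)
      then show "- d = (\<Sum>i\<in>I. (if i \<in> J then s \<bullet> e i else (a i y0 \<bullet> - d) / h i x0 y0) *\<^sub>R a i y0)"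
        using that by (simp add: E'_def zero_prod_def py_def pz_def del: inner_minus_right cong: sum.cong)
      have "H' j (0, 0) = 0" if "j \<in> J" for j using that JI H'0[of j 0] by auto
      moreover have "snd (E' (0, d, 0, s)) = 0" using that by simp
      ultimately show "s + (\<Sum>j\<in>J. (a j y0 \<bullet> - d - s \<bullet> e j) *\<^sub>R e j) = 0"
        by (simp add: E'_def py_def pz_def ps_def cong: sum.cong)
    qed
    then show ?thesis by simp
  qed
  \<comment> \<open>The bound 1 keeps 1 + T i w positive, so the signs of h i x0 y and h i x z agree
    on the whole graph, also off the feasible set.\<close>
  define O1 where "O1 = {w \<in> O0. \<forall>i\<in>I. \<bar>T i w\<bar> < 1}"
  have O1: "open O1" unfolding O1_def
    by (rule open_Collect_abs_less[OF I O0]) (use cT Ck_on_imp_continuous_on in blast)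
  have sub: "O1 \<subseteq> O0" by (auto simp: O1_def)
  have pO1: "p \<in> O1" using pO0 Tp by (simp add: O1_def)
  obtain N where N: "open N" "p \<in> N" "N \<subseteq> O1"
    and graph: "\<forall>x. \<exists>U V f g. smooth_iso U V f g \<and>
        (\<forall>y z. (\<exists>s. (x, y, z, s) \<in> N \<and> E (x, y, z, s) = 0) \<longleftrightarrow> y \<in> U \<and> z = f y)"
    and op1: "\<forall>M. open M \<longrightarrow> M \<subseteq> N \<longrightarrow> open {(x, y). \<exists>z s. (x, y, z, s) \<in> M \<and> E (x, y, z, s) = 0}"
    and op2: "\<forall>M. open M \<longrightarrow> M \<subseteq> N \<longrightarrow> open {(x, z). \<exists>y s. (x, y, z, s) \<in> M \<and> E (x, y, z, s) = 0}"
    by (rule implicit_correspondence[OF O1 Ck_on_subset[OF cE sub] pO1 dE ker1 ker2])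
  \<comment> \<open>Over X, zeros of E are solutions of the original system with t read off as T.
    The converse \<open>shift_E\<close> packs the active t j into s.\<close>
  have E_solution: "h i x z = (1 + T i (x, y, z, s)) * h i x0 y" "z = y + (\<Sum>i\<in>I. T i (x, y, z, s) *\<^sub>R a i y)"
    if w: "(x, y, z, s) \<in> O0" and x: "x \<in> X" and E0: "E (x, y, z, s) = 0" and i: "i \<in> I" for x y z s i
  proof -
    show "z = y + (\<Sum>i\<in>I. T i (x, y, z, s) *\<^sub>R a i y)"
      using E0 by (simp add: E_def zero_prod_def py_def pz_def algebra_simps)
    have xz: "(x, z) \<in> W" using w by (simp add: O0_def pz_def)
    show "h i x z = (1 + T i (x, y, z, s)) * h i x0 y"
    proof (cases "i \<in> J")
      case True
      have "(s + (\<Sum>j\<in>J. (H j (x, z) - (1 + s \<bullet> e j) * h j x0 y - s \<bullet> e j) *\<^sub>R e j)) \<bullet> e i = 0"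
        using E0 by (simp add: E_def zero_prod_def py_def pz_def ps_def)
      then have "H i (x, z) = (1 + s \<bullet> e i) * h i x0 y"
        by (simp add: inner_add_left inner_sum_inj_Basis[OF JI(2) e True])
      then show ?thesis using True Hh[OF i x xz] by (simp add: T_def ps_def)
    next
      case False
      then have "h i x0 y \<noteq> 0" using w i by (auto simp: O0_def py_def)
      then show ?thesis using False Hh[OF i x xz] by (simp add: T_def py_def pz_def)
    qed
  qed
  have shift_E: "E (x, y, z, s) = 0"
    if w: "(x, y, z, s) \<in> O0" and x: "x \<in> X" and z: "z = y + (\<Sum>i\<in>I. t i *\<^sub>R a i y)"
      and t: "\<And>i. i \<in> I \<Longrightarrow> h i x z = (1 + t i) * h i x0 y" and s: "s = (\<Sum>j\<in>J. t j *\<^sub>R e j)" for x y z s t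
  proof -
    have xz: "(x, z) \<in> W" using w by (simp add: O0_def pz_def)
    have se: "s \<bullet> e j = t j" if "j \<in> J" for j
      unfolding s by (rule inner_sum_inj_Basis[OF JI(2) e that])
    have T: "T i (x, y, z, s) = t i" if i: "i \<in> I" for i
    proof (cases "i \<in> J")
      case True
      then show ?thesis using se by (simp add: T_def ps_def)
    next
      case False
      then have "h i x0 y \<noteq> 0" using w i by (auto simp: O0_def py_def)
      then show ?thesis using False Hh[OF i x xz] t[OF i]
        by (simp add: T_def py_def pz_def mult.assoc)
    qed
    have "(\<Sum>j\<in>J. (H j (x, z) - (1 + s \<bullet> e j) * h j x0 y - s \<bullet> e j) *\<^sub>R e j) = (\<Sum>j\<in>J. - (t j *\<^sub>R e j))"
    proof (rule sum.cong)
      fix j assume j: "j \<in> J"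
      then have "j \<in> I" using JI by blast
      then show "(H j (x, z) - (1 + s \<bullet> e j) * h j x0 y - s \<bullet> e j) *\<^sub>R e j = - (t j *\<^sub>R e j)"
        using se[OF j] t Hh[OF _ x xz] by simp
    qed simp
    moreover have "(\<Sum>i\<in>I. T i (x, y, z, s) *\<^sub>R a i y) = z - y"
      using z T by (simp cong: sum.cong)
    ultimately show ?thesis
      by (simp add: E_def zero_prod_def py_def pz_def ps_def sum_negf flip: s)
  qed
  obtain r where r: "r > 0" "ball p r \<subseteq> N"
    using N(1,2) open_contains_ball by blast
  \<comment> \<open>In \<open>near\<close> the distance to p is at most \<delta> from x, \<delta>
    from y, 2 * \<delta> from z and card J * \<delta> from the packed coefficients, which is less
    than r in total.\<close>
  define \<delta> where "\<delta> = r / (real (card J) + 5)"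
  have \<delta>: "\<delta> > 0" "(real (card J) + 5) * \<delta> = r" using r(1) by (auto simp: \<delta>_def)
  have near: "(x, y, z, (\<Sum>j\<in>J. t j *\<^sub>R e j)) \<in> N"
    if "dist x x0 < \<delta>" "dist y y0 < \<delta>" "norm (z - y) < \<delta>" "\<And>i. i \<in> I \<Longrightarrow> \<bar>t i\<bar> < \<delta>" for x y z t
  proof -
    have "norm (\<Sum>j\<in>J. t j *\<^sub>R e j) \<le> (\<Sum>j\<in>J. \<delta>)"
    proof (rule order_trans[OF norm_sum sum_mono])
      fix j assume j: "j \<in> J"
      then have "norm (e j) = 1" "\<bar>t j\<bar> \<le> \<delta>"
        using e(2) that(4)[of j] JI(1) by (auto simp: image_subset_iff less_imp_le subset_iff)
      then show "norm (t j *\<^sub>R e j) \<le> \<delta>" by simp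
    qed
    moreover have "norm (z - y0) \<le> norm (z - y) + norm (y - y0)"
      using norm_triangle_ineq[of "z - y" "y - y0"] by simp
    moreover have "norm (x - x0, y - y0, z - y0, (\<Sum>j\<in>J. t j *\<^sub>R e j))
        \<le> norm (x - x0) + (norm (y - y0) + (norm (z - y0) + norm (\<Sum>j\<in>J. t j *\<^sub>R e j)))"
      by (intro order_trans[OF norm_Pair_le] add_left_mono order_refl)
    ultimately have "norm (x - x0, y - y0, z - y0, (\<Sum>j\<in>J. t j *\<^sub>R e j)) < r"
      using that(1-3) \<delta> by (simp add: dist_norm algebra_simps)
    then have "dist p (x, y, z, (\<Sum>j\<in>J. t j *\<^sub>R e j)) < r"
      by (simp add: p_def dist_commute[of "(x0, y0, y0, 0)"]) (simp add: dist_norm)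
    then show ?thesis using r(2) by (auto simp: mem_ball)
  qed
  show ?thesis
  proof (rule that[OF \<delta>(1)]; intro ballI allI impI)
    fix x assume x: "x \<in> X" "dist x x0 < \<delta>"
    obtain U V f g where f: "smooth_iso U V f g"
      and gr: "\<And>y z. (\<exists>s. (x, y, z, s) \<in> N \<and> E (x, y, z, s) = 0) \<longleftrightarrow> y \<in> U \<and> z = f y"
      using spec[OF graph, of x] by blast
    have "y \<in> U \<and> z = f y" if y: "y \<in> ball y0 \<delta>" and ns: "normal_shift I h a x0 x \<delta> y z" for y z
    proof -
      obtain t where t: "norm (z - y) < \<delta>" "\<And>i. i \<in> I \<Longrightarrow> \<bar>t i\<bar> < \<delta>"
        "\<And>i. i \<in> I \<Longrightarrow> h i x z = (1 + t i) * h i x0 y" "z = y + (\<Sum>i\<in>I. t i *\<^sub>R a i y)"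
        using ns unfolding normal_shift_def by blast
      have n: "(x, y, z, (\<Sum>j\<in>J. t j *\<^sub>R e j)) \<in> N"
        using near[OF x(2) _ t(1,2)] y by (simp add: dist_commute)
      then have "E (x, y, z, (\<Sum>j\<in>J. t j *\<^sub>R e j)) = 0"
        using N(3) by (intro shift_E[OF _ x(1) t(4,3) refl]) (auto simp: O1_def)
      then show ?thesis using gr n by blast
    qed
    moreover have "h i x0 y \<le> 0 \<longleftrightarrow> h i x (f y) \<le> 0" if y: "y \<in> U" and i: "i \<in> I" for y i
    proof -
      obtain s where s: "(x, y, f y, s) \<in> N" "E (x, y, f y, s) = 0" using gr y by blast
      then have w: "(x, y, f y, s) \<in> O1" using N(3) by blast
      then have "\<bar>T i (x, y, f y, s)\<bar> < 1" using i by (simp add: O1_def)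
      then have "0 < 1 + T i (x, y, f y, s)" by linarith
      then show ?thesis
        using E_solution(1)[OF _ x(1) s(2) i] w by (simp add: O1_def mult_le_0_iff)
    qed
    ultimately show "\<exists>U V f g. smooth_iso U V f g \<and>
       (\<forall>y\<in>ball y0 \<delta>. \<forall>z. normal_shift I h a x0 x \<delta> y z \<longrightarrow> y \<in> U \<and> z = f y) \<and>
       (\<forall>y\<in>U. \<forall>i\<in>I. h i x0 y \<le> 0 \<longleftrightarrow> h i x (f y) \<le> 0)"
      using f by blast
  next
    fix \<epsilon> :: real assume \<epsilon>: "\<epsilon> > 0"
    \<comment> \<open>Zeros of E in M have coefficients and displacement below \<epsilon>; the
      openness clauses applied to M produce such zeros for all (x, y) near (x0, y0).\<close>
    define M where "M = {w \<in> N. \<forall>i\<in>I. \<bar>T i w\<bar> < \<epsilon>} \<inter> {w. norm (pz w - py w) < \<epsilon>}"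
    have "continuous_on UNIV (\<lambda>w. norm (pz w - py w))"
      using lin by (intro continuous_intros linear_continuous_on)
    then have "open ((\<lambda>w. norm (pz w - py w)) -` {..<\<epsilon>})"
      by (intro open_vimage) auto
    moreover have "open {w \<in> N. \<forall>i\<in>I. \<bar>T i w\<bar> < \<epsilon>}"
    proof (rule open_Collect_abs_less[OF I N(1)])
      show "continuous_on N (T i)" if "i \<in> I" for i
        using Ck_on_imp_continuous_on[OF cT[OF that]] N(3) by (auto simp: O1_def intro: continuous_on_subset)
    qed
    ultimately have M: "open M" "M \<subseteq> N" by (auto simp: M_def vimage_def)
    have pM: "p \<in> M" using N(2) Tp \<epsilon> by (simp add: M_def p)
    have ns: "normal_shift I h a x0 x \<epsilon> y z"
      if "(x, y, z, s) \<in> M" "E (x, y, z, s) = 0" "x \<in> X" for x y z s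
    proof -
      have w: "(x, y, z, s) \<in> O0" using that(1) M(2) N(3) by (auto simp: O1_def)
      have "z = y + (\<Sum>i\<in>I. T i (x, y, z, s) *\<^sub>R a i y)"
        using that(2) by (simp add: E_def zero_prod_def py_def pz_def algebra_simps)
      then show ?thesis
        using that(1) E_solution(1)[OF w that(3,2)] unfolding normal_shift_def
        by (intro conjI exI[of _ "\<lambda>i. T i (x, y, z, s)"]) (auto simp: M_def py_def pz_def)
    qed
    have Ep: "E p = 0"
      unfolding p_def by (rule shift_E[OF _ x0, of _ _ _ "\<lambda>_. 0"]) (use pO0 in \<open>auto simp: p_def\<close>)
    have o: "open ({(x, y). \<exists>z s. (x, y, z, s) \<in> M \<and> E (x, y, z, s) = 0} \<inter>
        {(x, z). \<exists>y s. (x, y, z, s) \<in> M \<and> E (x, y, z, s) = 0})" (is "open ?A")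
      by (intro open_Int op1[rule_format] op2[rule_format] M)
    have "(x0, y0) \<in> ?A" using pM Ep by (auto simp: p_def)
    then obtain \<rho> where \<rho>: "\<rho> > 0" "ball (x0, y0) \<rho> \<subseteq> ?A"
      using o open_contains_ball by blast
    show "\<exists>\<eta>>0. \<forall>x\<in>X. \<forall>y. dist x x0 < \<eta> \<longrightarrow> dist y y0 < \<eta> \<longrightarrow>
       (\<exists>z. normal_shift I h a x0 x \<epsilon> y z) \<and> (\<exists>w. normal_shift I h a x0 x \<epsilon> w y)"
    proof (intro exI[of _ "\<rho>/2"] conjI ballI allI impI)
      fix x y assume x: "x \<in> X" and d: "dist x x0 < \<rho>/2" "dist y y0 < \<rho>/2"
      have "norm (x0 - x, y0 - y) \<le> norm (x0 - x) + norm (y0 - y)" by (rule norm_Pair_le)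
      then have "(x, y) \<in> ball (x0, y0) \<rho>"
        using d by (simp add: mem_ball dist_norm norm_minus_commute)
      then have xy: "(x, y) \<in> ?A" using \<rho>(2) by blast
      then show "\<exists>z. normal_shift I h a x0 x \<epsilon> y z" using ns x by blast
      show "\<exists>w. normal_shift I h a x0 x \<epsilon> w y" using xy ns x by blast
    qed (use \<rho>(1) in simp)
  qed
qed

section \<open>Correction along the constraint gradients: global theory\<close>

lemma normal_shift_mono:
  assumes "normal_shift I h a x0 x \<epsilon> y z" "\<epsilon> \<le> \<epsilon>'"
  shows "normal_shift I h a x0 x \<epsilon>' y z"
proof -
  obtain t where "norm (z - y) < \<epsilon>" "\<forall>i\<in>I. \<bar>t i\<bar> < \<epsilon> \<and> h i x z = (1 + t i) * h i x0 y"
    "z = y + (\<Sum>i\<in>I. t i *\<^sub>R a i y)"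
    using assms(1) unfolding normal_shift_def by blast
  then show ?thesis
    unfolding normal_shift_def using assms(2) by (intro conjI exI[of _ t]) fastforce+
qed

lemma normal_shift_sign:
  assumes "normal_shift I h a x0 x \<epsilon> y z" "\<epsilon> \<le> 1" "i \<in> I"
  shows "h i x0 y \<le> 0 \<longleftrightarrow> h i x z \<le> 0"
proof -
  obtain t where t: "\<bar>t\<bar> < \<epsilon>" "h i x z = (1 + t) * h i x0 y"
    using assms(1,3) unfolding normal_shift_def by blast
  then have "0 < 1 + t" using assms(2) by linarith
  then show ?thesis using t(2) by (simp add: mult_le_0_iff)
qed

text \<open>A Lebesgue number argument. Covering K by balls of half the radius leaves the margin e:
  every point within e of K lies in a full ball around some c in C, for which P is known.\<close>

lemma compact_finite_radii:
  fixes K :: "'a::metric_space set"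
  assumes K: "compact K" and P: "\<And>y. y \<in> K \<Longrightarrow> \<exists>r>0. P y r"
  obtains C r e where "C \<subseteq> K" "(e::real) > 0" "\<And>c. c \<in> C \<Longrightarrow> P c (r c) \<and> 2 * e \<le> r c"
    "\<And>y. y \<in> K \<Longrightarrow> \<exists>c\<in>C. dist y c < r c / 2"
proof -
  obtain r where r: "\<And>y. y \<in> K \<Longrightarrow> r y > 0 \<and> P y (r y)" using P by metis
  obtain C where C: "C \<subseteq> K" "finite C" "K \<subseteq> (\<Union>c\<in>C. ball c (r c / 2))"
    by (rule compactE_image[OF K, of K "\<lambda>c. ball c (r c / 2)"]) (use r in force)+
  \<comment> \<open>The entry 1 keeps the minimum meaningful when K, and with it C, is
    empty.\<close>
  define e where "e = Min (insert 1 ((\<lambda>c. r c / 2) ` C))"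
  have "e > 0" unfolding e_def using C(1,2) r by (subst Min_gr_iff) auto
  moreover have "2 * e \<le> r c" if "c \<in> C" for c
  proof -
    have "e \<le> r c / 2" unfolding e_def using C(2) that by (intro Min_le) auto
    then show ?thesis by simp
  qed
  moreover have "\<exists>c\<in>C. dist y c < r c / 2" if "y \<in> K" for y
  proof -
    obtain c where "c \<in> C" "y \<in> ball c (r c / 2)" using C(3) \<open>y \<in> K\<close> by blast
    then show ?thesis by (auto simp: dist_commute)
  qed
  ultimately show ?thesis using that[of C e r] C(1) r by blast
qed

text \<open>The order of choices matters: a first cover fixes the scale d of uniqueness, then
  \<epsilon> is chosen, then a second cover gives the scale e on which \<epsilon>-shifts exist, and
  finally \<open>usc\<close> brings all points of F x within e of F x0. The last choice yields
  surjectivity, since sign preservation makes the preimages feasible.\<close>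

lemma global_normal_shift:
  fixes h :: "nat \<Rightarrow> 'x::euclidean_space \<Rightarrow> 'a::euclidean_space \<Rightarrow> real" and I :: "nat set"
  defines "F x \<equiv> {y. \<forall>i\<in>I. h i x y \<le> 0}"
  assumes K: "compact (F x0)"
    and loc: "\<And>y0. y0 \<in> F x0 \<Longrightarrow> \<exists>\<delta>>0. \<forall>x\<in>X. dist x x0 < \<delta> \<longrightarrow> (\<exists>U V f g. smooth_iso U V f g \<and>
       (\<forall>y\<in>ball y0 \<delta>. \<forall>z. normal_shift I h a x0 x \<delta> y z \<longrightarrow> y \<in> U \<and> z = f y) \<and>
       (\<forall>y\<in>U. \<forall>i\<in>I. h i x0 y \<le> 0 \<longleftrightarrow> h i x (f y) \<le> 0))"
    and ex: "\<And>y0 \<epsilon>. y0 \<in> F x0 \<Longrightarrow> \<epsilon> > 0 \<Longrightarrow> \<exists>\<eta>>0. \<forall>x\<in>X. \<forall>y. dist x x0 < \<eta> \<longrightarrow> dist y y0 < \<eta> \<longrightarrow>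
       (\<exists>z. normal_shift I h a x0 x \<epsilon> y z) \<and> (\<exists>w. normal_shift I h a x0 x \<epsilon> w y)"
    and usc: "\<And>\<eta>. \<eta> > 0 \<Longrightarrow> \<exists>\<rho>>0. \<forall>x\<in>X. dist x x0 < \<rho> \<longrightarrow> (\<forall>z\<in>F x. \<exists>y\<in>F x0. dist z y < \<eta>)"
  shows "\<exists>\<rho>>0. \<forall>x\<in>X. dist x x0 < \<rho> \<longrightarrow> (\<exists>\<phi>. ambient_diffeo (F x0) (F x) \<phi>)"
proof -
  define S where "S x = normal_shift I h a x0 x" for x
  define P where "P y0 \<delta> \<longleftrightarrow> (\<forall>x\<in>X. dist x x0 < \<delta> \<longrightarrow> (\<exists>U V f g. smooth_iso U V f g \<and>
       (\<forall>y\<in>ball y0 \<delta>. \<forall>z. S x \<delta> y z \<longrightarrow> y \<in> U \<and> z = f y) \<and>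
       (\<forall>y\<in>U. \<forall>i\<in>I. h i x0 y \<le> 0 \<longleftrightarrow> h i x (f y) \<le> 0)))" for y0 \<delta>
  have exP: "\<exists>\<delta>>0. P y0 \<delta>" if "y0 \<in> F x0" for y0
    using loc[OF that] unfolding P_def S_def .
  obtain C \<delta> d where C: "C \<subseteq> F x0" "d > 0" "\<And>c. c \<in> C \<Longrightarrow> P c (\<delta> c) \<and> 2 * d \<le> \<delta> c"
    "\<And>y. y \<in> F x0 \<Longrightarrow> \<exists>c\<in>C. dist y c < \<delta> c / 2"
    using compact_finite_radii[where P = P, OF K exP] by metis
  \<comment> \<open>d / 2 puts two starting points of shifts with the same end within d of each
    other, hence into one ball where the local diffeomorphism is injective; 1 is needed for
    \<open>normal_shift_sign\<close>.\<close>
  define \<epsilon> where "\<epsilon> = min (d / 2) 1"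
  have \<epsilon>: "\<epsilon> > 0" "\<epsilon> \<le> 1" "2 * \<epsilon> \<le> d" using C(2) by (auto simp: \<epsilon>_def)
  define Q where "Q y0 \<eta> \<longleftrightarrow> (\<forall>x\<in>X. \<forall>y. dist x x0 < \<eta> \<longrightarrow> dist y y0 < \<eta> \<longrightarrow>
       (\<exists>z. S x \<epsilon> y z) \<and> (\<exists>w. S x \<epsilon> w y))" for y0 \<eta>
  have exQ: "\<exists>\<eta>>0. Q y0 \<eta>" if "y0 \<in> F x0" for y0
    using ex[OF that \<epsilon>(1)] unfolding Q_def S_def .
  obtain C' \<eta> e where C': "C' \<subseteq> F x0" "e > 0" "\<And>c. c \<in> C' \<Longrightarrow> Q c (\<eta> c) \<and> 2 * e \<le> \<eta> c"
    "\<And>y. y \<in> F x0 \<Longrightarrow> \<exists>c\<in>C'. dist y c < \<eta> c / 2"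
    using compact_finite_radii[where P = Q, OF K exQ] by metis
  obtain \<rho> where \<rho>: "\<rho> > 0" "\<forall>x\<in>X. dist x x0 < \<rho> \<longrightarrow> (\<forall>z\<in>F x. \<exists>y\<in>F x0. dist z y < e)"
    using usc[OF C'(2)] by blast
  show ?thesis
  proof (intro exI[of _ "min \<rho> (min d e)"] conjI ballI impI)
    show "0 < min \<rho> (min d e)" using \<rho>(1) C(2) C'(2) by simp
    fix x assume x: "x \<in> X" and xd: "dist x x0 < min \<rho> (min d e)"
    have dx: "dist x x0 < \<rho>" "dist x x0 < d" "dist x x0 < e" using xd by auto
    have loc': "\<exists>c U V f g. dist p c < \<delta> c / 2 \<and> 2 * d \<le> \<delta> c \<and> smooth_iso U V f g \<and>
       (\<forall>y\<in>ball c (\<delta> c). \<forall>z. S x \<epsilon> y z \<longrightarrow> y \<in> U \<and> z = f y) \<and>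
       (\<forall>y\<in>U. \<forall>i\<in>I. h i x0 y \<le> 0 \<longleftrightarrow> h i x (f y) \<le> 0)" if p: "p \<in> F x0" for p
    proof -
      obtain c where c: "c \<in> C" "dist p c < \<delta> c / 2" using C(4)[OF p] by blast
      have d: "2 * d \<le> \<delta> c" using C(3)[OF c(1)] by blast
      then have "dist x x0 < \<delta> c" using dx(2) C(2) by linarith
      then obtain U V f g where f: "smooth_iso U V f g"
        "\<forall>y\<in>ball c (\<delta> c). \<forall>z. S x (\<delta> c) y z \<longrightarrow> y \<in> U \<and> z = f y"
        "\<forall>y\<in>U. \<forall>i\<in>I. h i x0 y \<le> 0 \<longleftrightarrow> h i x (f y) \<le> 0"
        using C(3)[OF c(1)] x unfolding P_def by blast
      have "S x (\<delta> c) y z" if "S x \<epsilon> y z" for y z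
        using normal_shift_mono[of I h a x0 x \<epsilon> y z "\<delta> c"] that \<epsilon>(3) d C(2) by (simp add: S_def)
      then show ?thesis using c(2) d f by blast
    qed
    have sign: "y \<in> F x0 \<longleftrightarrow> z \<in> F x" if "S x \<epsilon> y z" for y z
      using normal_shift_sign[OF that[unfolded S_def] \<epsilon>(2)] by (auto simp: F_def)
    have uniq: "z = z'" if y: "y \<in> F x0" and S: "S x \<epsilon> y z" "S x \<epsilon> y z'" for y z z'
    proof -
      obtain c U V f g where "dist y c < \<delta> c / 2" "2 * d \<le> \<delta> c"
        "\<forall>y\<in>ball c (\<delta> c). \<forall>z. S x \<epsilon> y z \<longrightarrow> y \<in> U \<and> z = f y"
        using loc'[OF y] by metis
      moreover from this have "y \<in> ball c (\<delta> c)"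
        using C(2) by (simp add: dist_commute)
      ultimately show ?thesis using S by metis
    qed
    have inj: "y = y'" if y: "y \<in> F x0" and S: "S x \<epsilon> y z" "S x \<epsilon> y' z" for y y' z
    proof -
      obtain c U V f g where c: "dist y c < \<delta> c / 2" "2 * d \<le> \<delta> c" and f: "smooth_iso U V f g"
        "\<forall>y\<in>ball c (\<delta> c). \<forall>z. S x \<epsilon> y z \<longrightarrow> y \<in> U \<and> z = f y"
        using loc'[OF y] by metis
      have "dist y z < \<epsilon>" "dist y' z < \<epsilon>"
        using S by (auto simp: S_def normal_shift_def dist_norm norm_minus_commute)
      then have "dist y' y < d"
        using \<epsilon>(3) dist_triangle2[of y' y z] by linarith
      then have "dist y' c < \<delta> c"
        using c dist_triangle[of y' c y] by linarith
      then have "y \<in> ball c (\<delta> c)" "y' \<in> ball c (\<delta> c)"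
        using c C(2) by (auto simp: dist_commute)
      then show ?thesis using f(2) S smooth_isoD(6)[OF f(1)] by metis
    qed
    have ex1: "\<exists>z. S x \<epsilon> y z" if y: "y \<in> F x0" for y
    proof -
      obtain c where c: "c \<in> C'" "dist y c < \<eta> c / 2" using C'(4)[OF y] by blast
      moreover have "2 * e \<le> \<eta> c" using C'(3)[OF c(1)] by blast
      ultimately have "dist x x0 < \<eta> c" "dist y c < \<eta> c" using dx(3) C'(2) by linarith+
      then show ?thesis using C'(3)[OF c(1)] x unfolding Q_def by blast
    qed
    have ex2: "\<exists>w. S x \<epsilon> w z" if z: "z \<in> F x" for z
    proof -
      obtain y where y: "y \<in> F x0" "dist z y < e" using \<rho>(2) x dx(1) z by blast
      obtain c where c: "c \<in> C'" "dist y c < \<eta> c / 2" using C'(4)[OF y(1)] by blast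
      moreover have "2 * e \<le> \<eta> c" using C'(3)[OF c(1)] by blast
      ultimately have "dist x x0 < \<eta> c" "dist z c < \<eta> c"
        using dx(3) C'(2) y(2) dist_triangle[of z c y] by linarith+
      then show ?thesis using C'(3)[OF c(1)] x unfolding Q_def by blast
    qed
    \<comment> \<open>By \<open>uniq\<close> the choice is forced on F x0, so the local
      diffeomorphisms around different centres all extend this one map.\<close>
    define \<phi> where "\<phi> y = (SOME z. S x \<epsilon> y z)" for y
    have \<phi>: "S x \<epsilon> y (\<phi> y)" if "y \<in> F x0" for y
      unfolding \<phi>_def using ex1[OF that] by (rule someI_ex)
    have "bij_betw \<phi> (F x0) (F x)"
      unfolding bij_betw_def
    proof
      show "inj_on \<phi> (F x0)" using inj \<phi> by (metis inj_onI)
      have "\<exists>y\<in>F x0. z = \<phi> y" if "z \<in> F x" for z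
        using ex2[OF that] sign \<phi> uniq that by metis
      then show "\<phi> ` F x0 = F x" using sign \<phi> by blast
    qed
    moreover have "\<exists>U V f g. p \<in> U \<and> smooth_iso U V f g \<and> (\<forall>y\<in>U \<inter> F x0. f y = \<phi> y) \<and>
        (\<forall>y\<in>U. y \<in> F x0 \<longleftrightarrow> f y \<in> F x)" if p: "p \<in> F x0" for p
    proof -
      obtain c U V f g where c: "dist p c < \<delta> c / 2" "2 * d \<le> \<delta> c" and f: "smooth_iso U V f g"
        "\<forall>y\<in>ball c (\<delta> c). \<forall>z. S x \<epsilon> y z \<longrightarrow> y \<in> U \<and> z = f y"
        "\<forall>y\<in>U. \<forall>i\<in>I. h i x0 y \<le> 0 \<longleftrightarrow> h i x (f y) \<le> 0"
        using loc'[OF p] by metis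
      have pc: "p \<in> ball c (\<delta> c)" using c C(2) by (auto simp: dist_commute)
      then have "p \<in> U" using f(2) \<phi>[OF p] by blast
      moreover have "smooth_iso (U \<inter> ball c (\<delta> c)) (f ` (U \<inter> ball c (\<delta> c))) f g"
        using smooth_isoD(1)[OF f(1)] by (intro smooth_iso_restrict[OF f(1)]) auto
      moreover have "f y = \<phi> y" if "y \<in> (U \<inter> ball c (\<delta> c)) \<inter> F x0" for y
        using f(2) \<phi>[of y] that by auto
      moreover have "y \<in> F x0 \<longleftrightarrow> f y \<in> F x" if "y \<in> U \<inter> ball c (\<delta> c)" for y
        using f(3) that by (auto simp: F_def)
      ultimately show ?thesis using pc by blast
    qed
    ultimately show "\<exists>\<phi>. ambient_diffeo (F x0) (F x) \<phi>"
      unfolding ambient_diffeo_def by blast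
  qed
qed

section \<open>Charts at regular points\<close>

text \<open>The negated active constraints serve as the first coordinates. The active gradients are
  completed to a basis, and the added vectors give the remaining coordinates as linear functionals.
  A kernel vector of the derivative is orthogonal to this basis, hence zero.\<close>

lemma mgb_at_regular_point:
  fixes u :: "'i \<Rightarrow> real^'m \<Rightarrow> real" and a :: "'i \<Rightarrow> real^'m"
  assumes I: "finite I" and u: "\<And>i k. i \<in> I \<Longrightarrow> Ck_on k UNIV (u i)"
    and du: "\<And>i. i \<in> I \<Longrightarrow> (u i has_derivative (\<lambda>v. a i \<bullet> v)) (at y0)"
    and y0: "\<And>i. i \<in> I \<Longrightarrow> u i y0 \<le> 0" and J: "J = {i \<in> I. u i y0 = 0}"
    and licq: "inj_on a J" "independent (a ` J)"
  shows "mgb_at {y. \<forall>i\<in>I. u i y \<le> 0} y0 0 (card J)"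
proof -
  have JI: "J \<subseteq> I" "finite J" using I by (auto simp: J)
  obtain B where B: "a ` J \<subseteq> B" "independent B" "UNIV \<subseteq> span B"
    using maximal_independent_subset_extend[of "a ` J" UNIV] licq(2) by auto
  have fB: "finite B" using B(2) by (rule independent_bound[THEN conjunct1])
  have cB: "card B = CARD('m)"
    using basis_card_eq_dim[of B UNIV] B by simp
  define m where "m = CARD('m)"
  define r where "r = card J"
  have r: "card (a ` J) = r" using licq(1) by (simp add: card_image r_def)
  then have rm: "r \<le> m" using card_mono[OF fB B(1)] cB by (simp add: m_def)
  obtain b1 where b1: "bij_betw b1 {1..r} J"
    using ex_bij_betw_nat_finite_1[OF JI(2)] unfolding r_def by blast
  have "card {r+1..m} = card (B - a ` J)"
    using r cB JI(2) B(1) by (simp add: card_Diff_subset m_def)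
  then obtain b2 where b2: "bij_betw b2 {r+1..m} (B - a ` J)"
    using finite_same_card_bij[of "{r+1..m}" "B - a ` J"] fB by blast
  obtain e :: "nat \<Rightarrow> 'm" where e: "bij_betw e {1..m} UNIV"
    using ex_bij_betw_nat_finite_1[of "UNIV :: 'm set"] unfolding m_def by auto
  define G where "G i y = (if i \<le> r then - u (b1 i) y else b2 i \<bullet> (y - y0))" for i y
  define G' where "G' i w = (if i \<le> r then - (a (b1 i) \<bullet> w) else b2 i \<bullet> w)" for i w
  define \<psi> where "\<psi> y = (\<Sum>i\<in>{1..m}. G i y *\<^sub>R axis (e i) (1::real))" for y
  have b1I: "b1 i \<in> I" "b1 i \<in> J" if "i \<in> {1..m}" "i \<le> r" for i
    using bij_betwE[OF b1] that JI(1) by auto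
  have comp: "(\<Sum>i\<in>{1..m}. c i *\<^sub>R axis (e i) (1::real)) $ e j = c j" if j: "j \<in> {1..m}" for c j
  proof -
    have "(\<Sum>i\<in>{1..m}. c i *\<^sub>R axis (e i) (1::real)) $ e j = (\<Sum>i\<in>{1..m}. if i = j then c i else 0)"
      unfolding sum_component
      using e j by (intro sum.cong) (auto simp: axis_def bij_betw_def inj_on_eq_iff)
    then show ?thesis using j by simp
  qed
  have Ck: "Ck_on k UNIV \<psi>" for k
  proof -
    have "Ck_on k UNIV (G i)" if "i \<in> {1..m}" for i
    proof (cases "i \<le> r")
      case True
      have "Ck_on k UNIV (\<lambda>y. - 1 * u (b1 i) y)"
        using b1I[OF that True] by (intro Ck_on_mult Ck_on_const u) auto
      then show ?thesis using True by (simp add: G_def[abs_def])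
    next
      case False
      have "Ck_on k UNIV (\<lambda>y. b2 i \<bullet> (y + - y0))"
        by (intro Ck_on_inner Ck_on_add Ck_on_const Ck_on_bounded_linear bounded_linear_ident) auto
      then show ?thesis using False by (simp add: G_def[abs_def])
    qed
    then show ?thesis
      unfolding \<psi>_def[abs_def] by (intro Ck_on_sum Ck_on_scaleR Ck_on_const) auto
  qed
  have der: "(\<psi> has_derivative (\<lambda>w. \<Sum>i\<in>{1..m}. G' i w *\<^sub>R axis (e i) 1)) (at y0)"
    unfolding \<psi>_def[abs_def]
  proof (intro has_derivative_sum has_derivative_scaleR_left)
    fix i assume i: "i \<in> {1..m}"
    show "(G i has_derivative G' i) (at y0)"
    proof (cases "i \<le> r")
      case True
      then show ?thesis
        using has_derivative_minus[OF du[OF b1I(1)[OF i True]]] by (simp add: G_def[abs_def] G'_def[abs_def])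
    next
      case False
      have "((\<lambda>y. b2 i \<bullet> (y - y0)) has_derivative (\<lambda>w. b2 i \<bullet> w)) (at y0)"
        by (auto intro!: derivative_eq_intros)
      then show ?thesis using False by (simp add: G_def[abs_def] G'_def[abs_def])
    qed
  qed
  have ker: "w = 0" if w: "(\<Sum>i\<in>{1..m}. G' i w *\<^sub>R axis (e i) (1::real)) = 0" for w
  proof -
    have G0: "G' i w = 0" if "i \<in> {1..m}" for i
      using comp[OF that, of "\<lambda>i. G' i w"] by (simp only: w zero_index)
    have "orthogonal w b" if b: "b \<in> B" for b
    proof (cases "b \<in> a ` J")
      case True
      then obtain i where "i \<in> {1..r}" "b = a (b1 i)" using b1 by (auto simp: bij_betw_def)
      then show ?thesis using G0[of i] rm by (simp add: G'_def orthogonal_def inner_commute)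
    next
      case False
      then have "b \<in> b2 ` {r+1..m}" using b2 b by (simp add: bij_betw_def)
      then obtain i where "i \<in> {r+1..m}" "b = b2 i" by blast
      then show ?thesis using G0[of i] rm by (simp add: G'_def orthogonal_def inner_commute)
    qed
    then have "orthogonal w w"
      using orthogonal_to_span[of w B w] B(3) by auto
    then show ?thesis by (simp add: orthogonal_def)
  qed
  obtain U V g where U: "y0 \<in> U" and i: "smooth_iso U V \<psi> g"
    by (rule smooth_local_inverse[OF open_UNIV Ck UNIV_I der ker])
  \<comment> \<open>Here the inactive constraints stay negative, so the active ones alone decide
    feasibility.\<close>
  define U1 where "U1 = U \<inter> (\<Inter>i\<in>I-J. u i -` {..<0})"
  have "open U1" unfolding U1_def
  proof (intro open_Int open_INT ballI smooth_isoD(1)[OF i])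
    show "open (u i -` {..<0})" if "i \<in> I - J" for i
      using Ck_on_imp_continuous_on[OF u[of i]] that by (intro open_vimage) auto
  qed (use I in simp)
  then have i1: "smooth_iso U1 (\<psi> ` U1) \<psi> g"
    by (intro smooth_iso_restrict[OF i]) (auto simp: U1_def)
  have y0U1: "y0 \<in> U1" using U y0 by (force simp: U1_def J)
  have "\<psi> y0 $ c = 0" for c
  proof -
    obtain j where j: "j \<in> {1..m}" "c = e j" using e by (metis UNIV_I bij_betw_def imageE)
    have "G j y0 = 0" using b1I(2)[OF j(1)] by (auto simp: G_def J)
    then show ?thesis using comp[OF j(1), of "\<lambda>i. G i y0"] j(2) by (simp add: \<psi>_def)
  qed
  then have \<psi>0: "\<psi> y0 = 0" by (simp add: vec_eq_iff)
  have mem: "(\<forall>i\<in>I. u i y \<le> 0) \<longleftrightarrow> (\<forall>i\<in>{1..r}. \<psi> y $ e i \<ge> 0)" if y: "y \<in> U1" for y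
  proof -
    have "\<psi> y $ e i = - u (b1 i) y" if "i \<in> {1..r}" for i
      using comp[of i "\<lambda>i. G i y"] that rm by (simp add: \<psi>_def G_def)
    then have "(\<forall>i\<in>{1..r}. \<psi> y $ e i \<ge> 0) \<longleftrightarrow> (\<forall>i\<in>{1..r}. u (b1 i) y \<le> 0)"
      by simp
    also have "\<dots> \<longleftrightarrow> (\<forall>j\<in>J. u j y \<le> 0)"
      using b1 by (auto simp: bij_betw_def)
    also have "\<dots> \<longleftrightarrow> (\<forall>i\<in>I. u i y \<le> 0)"
    proof -
      have "u i y \<le> 0" if "i \<in> I" "i \<notin> J" for i
        using y that by (auto simp: U1_def intro: less_imp_le)
      then show ?thesis using JI(1) by blast
    qed
    finally show ?thesis by simp
  qed
  have "\<psi> ` (U1 \<inter> {y. \<forall>i\<in>I. u i y \<le> 0}) = {v \<in> \<psi> ` U1. \<forall>i\<in>{1..r}. v $ e i \<ge> 0}"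
    using mem by auto
  then show ?thesis
    unfolding mgb_at_def
    using rm e y0U1 \<psi>0 smooth_isoD(1,2)[OF i1] smooth_iso_imp_diffeomorphism[OF i1]
    by (intro conjI exI[of _ U1] exI[of _ "\<psi> ` U1"] exI[of _ \<psi>] exI[of _ e])
      (simp_all add: m_def r_def)
qed

section \<open>Parametrised feasible sets\<close>

lemma smooth_on_slice:
  fixes f :: "'a::euclidean_space \<Rightarrow> 'b::euclidean_space \<Rightarrow> 'c::euclidean_space"
  assumes f: "smooth_on (X \<times> UNIV) (\<lambda>(x, y). f x y)" and x: "x \<in> X"
  shows "Ck_on k UNIV (f x)"
proof -
  have "Ck_on k UNIV (\<lambda>y::'b. (x, y))" for k
    by (intro Ck_on_Pair Ck_on_const Ck_on_bounded_linear[OF bounded_linear_ident] open_UNIV)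
  then have "smooth_on UNIV (Pair x :: 'b \<Rightarrow> _)" by (simp add: smooth_on_iff_open)
  then have "smooth_on UNIV (\<lambda>y. (\<lambda>(x, y). f x y) (x, y))"
    by (rule smooth_on_compose[OF _ f]) (use x in auto)
  then have "smooth_on UNIV (f x)" by simp
  then show ?thesis using smooth_on_iff_open[OF open_UNIV] by blast
qed

text \<open>Identifies the description by \<open>THE\<close> with the Riesz vector of the
  derivative. The basis formula is what makes the gradient visibly smooth in y.\<close>

lemma gradient_eq:
  assumes "(f has_derivative f') (at y)"
  shows "gradient f y = (\<Sum>b\<in>Basis. f' b *\<^sub>R b)" and "f' v = gradient f y \<bullet> v"
proof -
  define D where "D = (\<Sum>b\<in>Basis. f' b *\<^sub>R b)"
  have f': "f' v = v \<bullet> D" for v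
    unfolding D_def inner_sum_right inner_scaleR_right
    using linear_euclidean_expansion[OF has_derivative_linear[OF assms], of v]
    by (simp add: mult.commute)
  then have "GDERIV f y :> D"
    using assms unfolding gderiv_def by (metis ext)
  moreover have "D' = D" if "GDERIV f y :> D'" for D'
    using has_derivative_unique[OF assms that[unfolded gderiv_def]] f'
    by (metis vector_eq_ldot)
  ultimately have g: "gradient f y = D"
    unfolding gradient_def by (rule the_equality)
  then show "gradient f y = (\<Sum>b\<in>Basis. f' b *\<^sub>R b)" by (simp only: D_def)
  show "f' v = gradient f y \<bullet> v" unfolding g using f'[of v] by (metis inner_commute)
qed

lemma has_derivative_gradient:
  assumes "\<And>k. Ck_on k UNIV f"
  shows "(f has_derivative (\<lambda>v. gradient f y \<bullet> v)) (at y)"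
proof -
  have d: "(f has_derivative frechet_derivative f (at y)) (at y)"
    using Ck_on_Suc_has_derivative[OF assms UNIV_I] .
  moreover have "frechet_derivative f (at y) = (\<lambda>v. gradient f y \<bullet> v)"
    using gradient_eq(2)[OF d] by blast
  ultimately show ?thesis by simp
qed

lemma Ck_on_gradient:
  assumes f: "\<And>k. Ck_on k UNIV f"
  shows "Ck_on k UNIV (gradient f)"
proof (rule Ck_on_cong)
  show "Ck_on k UNIV (\<lambda>y. \<Sum>b\<in>Basis. frechet_derivative f (at y) b *\<^sub>R b)"
    using f[of "Suc k"] by (intro Ck_on_sum Ck_on_scaleR Ck_on_const) auto
  show "(\<Sum>b\<in>Basis. frechet_derivative f (at y) b *\<^sub>R b) = gradient f y" for y
    using gradient_eq(1)[OF Ck_on_Suc_has_derivative[OF f UNIV_I]] by simp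
qed simp

lemma smooth_on_common_extension:
  assumes "finite I" "\<And>i. i \<in> I \<Longrightarrow> smooth_on S (f i)" "p \<in> S"
  shows "\<exists>W H. open W \<and> p \<in> W \<and> (\<forall>i\<in>I. (\<forall>k. Ck_on k W (H i)) \<and> (\<forall>z\<in>W \<inter> S. H i z = f i z))"
proof -
  have "\<exists>U F. open U \<and> p \<in> U \<and> (\<forall>k. Ck_on k U F) \<and> (\<forall>z\<in>U \<inter> S. F z = f i z)" if "i \<in> I" for i
    using assms(2)[OF that] assms(3) unfolding smooth_on_def by (rule bspec)
  then obtain U F where U: "\<And>i. i \<in> I \<Longrightarrow> open (U i) \<and> p \<in> U i \<and> (\<forall>k. Ck_on k (U i) (F i)) \<and>
      (\<forall>z\<in>U i \<inter> S. F i z = f i z)"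
    by metis
  have "Ck_on k (\<Inter>i\<in>I. U i) (F i)" if "i \<in> I" for i k
    by (rule Ck_on_subset[of k "U i"]) (use U that in auto)
  then show ?thesis
    using U assms(1) by (intro exI[of _ "\<Inter>i\<in>I. U i"] exI[of _ F]) auto
qed

text \<open>Since R does not depend on x, points z n of F (x n) that stay \<eta> away from F x0
  would have a limit point, and continuity puts it into F x0. The uniform bound thus excludes pieces
  of F x that come in from infinity as x tends to x0.\<close>

lemma sublevel_sets_upper_semicontinuous:
  fixes h :: "nat \<Rightarrow> 'x::euclidean_space \<Rightarrow> 'a::euclidean_space \<Rightarrow> real" and I :: "nat set"
  defines "F x \<equiv> {y. \<forall>i\<in>I. h i x y \<le> 0}"
  assumes cont: "\<And>i. i \<in> I \<Longrightarrow> continuous_on (X \<times> UNIV) (\<lambda>(x, y). h i x y)"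
    and bound: "\<And>x. x \<in> X \<Longrightarrow> F x \<subseteq> cball 0 R" and x0: "x0 \<in> X" and "\<eta> > 0"
  shows "\<exists>\<rho>>0. \<forall>x\<in>X. dist x x0 < \<rho> \<longrightarrow> (\<forall>z\<in>F x. \<exists>y\<in>F x0. dist z y < \<eta>)"
proof (rule ccontr)
  assume neg: "\<not> ?thesis"
  have "\<exists>x z. x \<in> X \<and> dist x x0 < inverse (real (Suc n)) \<and> z \<in> F x \<and> (\<forall>y\<in>F x0. dist z y \<ge> \<eta>)" for n
    using neg by (meson inverse_positive_iff_positive not_le of_nat_0_less_iff zero_less_Suc)
  then obtain x z where xz: "\<And>n. x n \<in> X" "\<And>n. dist (x n) x0 < inverse (real (Suc n))"
    "\<And>n. z n \<in> F (x n)" "\<And>n y. y \<in> F x0 \<Longrightarrow> dist (z n) y \<ge> \<eta>"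
    by metis
  have "x \<longlonglongrightarrow> x0"
  proof (rule metric_LIMSEQ_I)
    fix r :: real assume "0 < r"
    then obtain N where N: "inverse (real (Suc N)) < r" using reals_Archimedean by blast
    have "dist (x n) x0 < r" if "n \<ge> N" for n
    proof -
      have "inverse (real (Suc n)) \<le> inverse (real (Suc N))"
        using that by (intro le_imp_inverse_le) auto
      then show ?thesis using xz(2)[of n] N by linarith
    qed
    then show "\<exists>N. \<forall>n\<ge>N. dist (x n) x0 < r" by blast
  qed
  moreover have "\<forall>n. z n \<in> cball 0 R" using bound xz(1,3) by blast
  then obtain l s where s: "strict_mono s" "(z \<circ> s) \<longlonglongrightarrow> l"
    using compact_cball[of "0 :: 'a" R] unfolding compact_def by metis
  ultimately have lim: "(\<lambda>n. (x (s n), z (s n))) \<longlonglongrightarrow> (x0, l)"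
    using LIMSEQ_subseq_LIMSEQ[of x x0 s] by (intro tendsto_Pair) (auto simp: o_def)
  have "h i x0 l \<le> 0" if i: "i \<in> I" for i
  proof -
    have "(\<lambda>n. (\<lambda>(x, y). h i x y) (x (s n), z (s n))) \<longlonglongrightarrow> (\<lambda>(x, y). h i x y) (x0, l)"
      by (rule continuous_on_tendsto_compose[OF cont[OF i] lim]) (use x0 xz(1) in auto)
    then have "(\<lambda>n. h i (x (s n)) (z (s n))) \<longlonglongrightarrow> h i x0 l" by simp
    then show ?thesis
      using xz(3) i by (intro LIMSEQ_le_const2) (auto simp: F_def)
  qed
  then have "l \<in> F x0" by (simp add: F_def)
  moreover obtain n where "dist (z (s n)) l < \<eta>"
    using metric_LIMSEQ_D[OF s(2) \<open>\<eta> > 0\<close>] by (auto simp: o_def)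
  ultimately show False using xz(4) by (meson not_le)
qed

lemma nearby_feasible_sets_diffeomorphic:
  fixes h :: "nat \<Rightarrow> real^'n \<Rightarrow> real^'m \<Rightarrow> real"
  assumes smooth: "\<And>i. i \<in> {1..k} \<Longrightarrow> smooth_on (X \<times> UNIV) (\<lambda>(x, y). h i x y)"
    and bound: "\<And>x. x \<in> X \<Longrightarrow> feasible_set k h x \<subseteq> cball 0 R"
    and licq: "LICQ k h x0" and x0: "x0 \<in> X"
  shows "\<exists>\<rho>>0. \<forall>x\<in>X. dist x x0 < \<rho> \<longrightarrow>
    (\<exists>\<phi>. ambient_diffeo (feasible_set k h x0) (feasible_set k h x) \<phi>)"
proof -
  define a where "a i = gradient (h i x0)" for i
  have u: "Ck_on j UNIV (h i x)" if "i \<in> {1..k}" "x \<in> X" for i j x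
    using smooth_on_slice[OF smooth[OF that(1)] that(2)] .
  have K: "compact (feasible_set k h x0)"
  proof -
    have "closed (\<Inter>i\<in>{1..k}. {y. h i x0 y \<le> 0})"
      using Ck_on_imp_continuous_on[OF u[OF _ x0]]
      by (intro closed_INT ballI closed_Collect_le continuous_on_const) blast
    moreover have "(\<Inter>i\<in>{1..k}. {y. h i x0 y \<le> 0}) = feasible_set k h x0"
      by (auto simp: feasible_set_def)
    moreover have "bounded (feasible_set k h x0)"
      using bound[OF x0] bounded_subset bounded_cball by blast
    ultimately show ?thesis by (simp add: compact_eq_bounded_closed)
  qed
  have loc: "(\<exists>\<delta>>0. \<forall>x\<in>X. dist x x0 < \<delta> \<longrightarrow> (\<exists>U V f g. smooth_iso U V f g \<and>
       (\<forall>y\<in>ball y0 \<delta>. \<forall>z. normal_shift {1..k} h a x0 x \<delta> y z \<longrightarrow> y \<in> U \<and> z = f y) \<and>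
       (\<forall>y\<in>U. \<forall>i\<in>{1..k}. h i x0 y \<le> 0 \<longleftrightarrow> h i x (f y) \<le> 0))) \<and>
       (\<forall>\<epsilon>>0. \<exists>\<eta>>0. \<forall>x\<in>X. \<forall>y. dist x x0 < \<eta> \<longrightarrow> dist y y0 < \<eta> \<longrightarrow>
       (\<exists>z. normal_shift {1..k} h a x0 x \<epsilon> y z) \<and> (\<exists>w. normal_shift {1..k} h a x0 x \<epsilon> w y))"
    if y0: "y0 \<in> {y. \<forall>i\<in>{1..k}. h i x0 y \<le> 0}" for y0
  proof -
    have "(x0, y0) \<in> X \<times> UNIV" using x0 by simp
    then have "\<exists>W H. open W \<and> (x0, y0) \<in> W \<and> (\<forall>i\<in>{1..k}. (\<forall>j. Ck_on j W (H i)) \<and>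
        (\<forall>z\<in>W \<inter> X \<times> UNIV. H i z = (\<lambda>(x, y). h i x y) z))"
      by (intro smooth_on_common_extension[where f = "\<lambda>i (x, y). h i x y"] smooth finite_atLeastAtMost)
    then obtain W H where WH: "open W \<and> (x0, y0) \<in> W \<and> (\<forall>i\<in>{1..k}. (\<forall>j. Ck_on j W (H i)) \<and>
        (\<forall>z\<in>W \<inter> X \<times> UNIV. H i z = (\<lambda>(x, y). h i x y) z))"
      by (elim exE) (rule that)
    then have W: "open W" "(x0, y0) \<in> W" by auto
    have H: "Ck_on j W (H i)" if "i \<in> {1..k}" for i j using WH that by blast
    have Hh: "H i (x, y) = h i x y" if "i \<in> {1..k}" "x \<in> X" "(x, y) \<in> W" for i x y
    proof -
      have "H i (x, y) = (\<lambda>(x, y). h i x y) (x, y)" using WH that by blast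
      then show ?thesis by simp
    qed
    have ca: "Ck_on j UNIV (a i)" if "i \<in> {1..k}" for i j
      unfolding a_def by (rule Ck_on_gradient[OF u[OF that x0]])
    have du: "(h i x0 has_derivative (\<lambda>v. a i y0 \<bullet> v)) (at y0)" if "i \<in> {1..k}" for i
      unfolding a_def by (rule has_derivative_gradient[OF u[OF that x0]])
    have neg: "h i x0 y0 \<le> 0" if "i \<in> {1..k}" for i using y0 that by blast
    have l: "inj_on (\<lambda>i. a i y0) {i \<in> {1..k}. h i x0 y0 = 0}"
      "independent ((\<lambda>i. a i y0) ` {i \<in> {1..k}. h i x0 y0 = 0})"
      using licq y0 by (auto simp: LICQ_def feasible_set_def active_set_def a_def)
    obtain \<delta> where "\<delta> > 0" and
      \<delta>: "\<forall>x\<in>X. dist x x0 < \<delta> \<longrightarrow> (\<exists>U V f g. smooth_iso U V f g \<and>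
       (\<forall>y\<in>ball y0 \<delta>. \<forall>z. normal_shift {1..k} h a x0 x \<delta> y z \<longrightarrow> y \<in> U \<and> z = f y) \<and>
       (\<forall>y\<in>U. \<forall>i\<in>{1..k}. h i x0 y \<le> 0 \<longleftrightarrow> h i x (f y) \<le> 0))" and
      \<eta>: "\<forall>\<epsilon>>0. \<exists>\<eta>>0. \<forall>x\<in>X. \<forall>y. dist x x0 < \<eta> \<longrightarrow> dist y y0 < \<eta> \<longrightarrow>
       (\<exists>z. normal_shift {1..k} h a x0 x \<epsilon> y z) \<and> (\<exists>w. normal_shift {1..k} h a x0 x \<epsilon> w y)"
      by (rule local_normal_shift[where a = a,
            OF finite_atLeastAtMost W x0 H Hh u[OF _ x0] ca du neg refl l])
    show ?thesis
      by (intro conjI[OF _ \<eta>] exI[of _ \<delta>] conjI[OF \<open>\<delta> > 0\<close>] \<delta>)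
  qed
  have "\<exists>\<rho>>0. \<forall>x\<in>X. dist x x0 < \<rho> \<longrightarrow> (\<exists>\<phi>. ambient_diffeo
      {y. \<forall>i\<in>{1..k}. h i x0 y \<le> 0} {y. \<forall>i\<in>{1..k}. h i x y \<le> 0} \<phi>)"
  proof (rule global_normal_shift[where a = a, OF _ conjunct1[OF loc] mp[OF spec[OF conjunct2[OF loc]]]])
    show "compact {y. \<forall>i\<in>{1..k}. h i x0 y \<le> 0}" using K by (simp add: feasible_set_def)
    show "\<exists>\<rho>>0. \<forall>x\<in>X. dist x x0 < \<rho> \<longrightarrow> (\<forall>z\<in>{y. \<forall>i\<in>{1..k}. h i x y \<le> 0}.
        \<exists>y\<in>{y. \<forall>i\<in>{1..k}. h i x0 y \<le> 0}. dist z y < \<eta>)" if "\<eta> > 0" for \<eta>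
      using smooth_on_imp_continuous_on[OF smooth] bound x0 that
      by (intro sublevel_sets_upper_semicontinuous[where R = R]) (auto simp: feasible_set_def)
  qed
  then show ?thesis by (simp add: feasible_set_def)
qed

text \<open>Only inequalities occur, so q = 0 at every feasible point and the dimension is that of
  the ambient space, for every x. This is the common s of the theorem.\<close>

lemma mgb_of_dim_feasible_set:
  fixes h :: "nat \<Rightarrow> real^'n \<Rightarrow> real^'m \<Rightarrow> real"
  assumes u: "\<And>i j. i \<in> {1..k} \<Longrightarrow> Ck_on j UNIV (h i x)" and licq: "LICQ k h x"
  shows "mgb_of_dim CARD('m) (feasible_set k h x)"
proof -
  have "mgb_at (feasible_set k h x) y 0 (card (active_set k h x y))" if y: "y \<in> feasible_set k h x" for y
    unfolding feasible_set_def
  proof (rule mgb_at_regular_point[where a = "\<lambda>i. gradient (h i x) y"])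
    show "(h i x has_derivative (\<lambda>v. gradient (h i x) y \<bullet> v)) (at y)" if "i \<in> {1..k}" for i
      by (rule has_derivative_gradient[OF u[OF that]])
  qed (use u y licq in \<open>auto simp: LICQ_def feasible_set_def active_set_def\<close>)
  then show ?thesis by (auto simp: mgb_of_dim_def)
qed



theorem theorem2p1:
  fixes X :: "(real^'n) set"
    and g :: "real^'n \<Rightarrow> real^'m \<Rightarrow> real"
    and h :: "nat \<Rightarrow> real^'n \<Rightarrow> real^'m \<Rightarrow> real"
    and k :: nat
  assumes "connected X" and "mgb X"
    and "smooth_on (X \<times> UNIV) (\<lambda>(x, y). g x y)"
    and "\<And>i. i \<in> {1..k} \<Longrightarrow> smooth_on (X \<times> UNIV) (\<lambda>(x, y). h i x y)"
    and "\<And>x. x \<in> X \<Longrightarrow> feasible_set k h x \<noteq> {}"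
    and "\<exists>R>0. \<forall>x\<in>X. feasible_set k h x \<subseteq> {y. norm y \<le> R}"
    and "\<And>x. x \<in> X \<Longrightarrow> LICQ k h x"
  shows "\<exists>s. (\<forall>x\<in>X. mgb_of_dim s (feasible_set k h x)) \<and>
           (\<forall>x1\<in>X. \<forall>x2\<in>X. \<exists>\<phi>.
              diffeomorphism_between (feasible_set k h x1) (feasible_set k h x2) \<phi> \<and>
              stratification_preserving s (feasible_set k h x1) (feasible_set k h x2) \<phi>)"
proof -
  note smooth = assms(4) and licq = assms(7)
  obtain R where "\<forall>x\<in>X. feasible_set k h x \<subseteq> {y. norm y \<le> R}" using assms(6) by blast
  moreover have "{y :: real^'m. norm y \<le> R} = cball 0 R" by (auto simp: mem_cball_0)
  ultimately have bound: "feasible_set k h x \<subseteq> cball 0 R" if "x \<in> X" for x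
    using that by blast
  have "\<exists>\<phi>. ambient_diffeo (feasible_set k h x1) (feasible_set k h x2) \<phi>" if "x1 \<in> X" "x2 \<in> X" for x1 x2
  proof (rule connected_equivalence_relation[OF assms(1) that,
        where R = "\<lambda>x1 x2. \<exists>\<phi>. ambient_diffeo (feasible_set k h x1) (feasible_set k h x2) \<phi>"])
    fix x0 assume x0: "x0 \<in> X"
    obtain \<rho> where "\<rho> > 0" and \<rho>: "\<forall>x\<in>X. dist x x0 < \<rho> \<longrightarrow>
        (\<exists>\<phi>. ambient_diffeo (feasible_set k h x0) (feasible_set k h x) \<phi>)"
      using nearby_feasible_sets_diffeomorphic[OF smooth bound licq[OF x0] x0] by blast
    show "\<exists>T. openin (top_of_set X) T \<and> x0 \<in> T \<and>
        (\<forall>x\<in>T. \<exists>\<phi>. ambient_diffeo (feasible_set k h x0) (feasible_set k h x) \<phi>)"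
      using x0 \<open>\<rho> > 0\<close> \<rho> by (intro exI[of _ "X \<inter> ball x0 \<rho>"]) (auto simp: dist_commute)
  qed (use ambient_diffeo_sym ambient_diffeo_trans in blast)+
  then have "\<exists>\<phi>. diffeomorphism_between (feasible_set k h x1) (feasible_set k h x2) \<phi> \<and>
      stratification_preserving CARD('m) (feasible_set k h x1) (feasible_set k h x2) \<phi>"
    if "x1 \<in> X" "x2 \<in> X" for x1 x2
    using that ambient_diffeo_imp_diffeomorphism ambient_diffeo_stratification_preserving by blast
  moreover have "mgb_of_dim CARD('m) (feasible_set k h x)" if "x \<in> X" for x
    by (rule mgb_of_dim_feasible_set[OF smooth_on_slice[OF smooth that] licq[OF that]])
  ultimately show ?thesis by blast
qed

end
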